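(* Let $\Gamma$ be a non-elementary (word-)hyperbolic group, $S$ any finite symmetric generating set, and $\mathcal{G}_S=|\cdot|_S$ the length function given by the word metric. Then the Hardy-Littlewood operator $\mathcal{M}$ associated with the balls defined by $\mathcal{G}_S$ satisfies the weak-type $(1,1)$-maximal inequality in $\ell^1(\Gamma)$: there is a constant $C$ such that for every $f\in\ell^1(\Gamma)$ and every $\eta>0$, $$|\{x\in\Gamma:\mathcal{M}f(x)\ge\eta\}|\le\frac{C}{\eta}\|f\|_{\ell^1(\Gamma)}.$$
   Context: $|\cdot|$ of a set denotes cardinality. With $d(u,v)=|u^{-1}v|_S$ and $B_r=\{\gamma\in\Gamma:|\gamma|_S<r\}$, and a fixed $r_0\ge0$, the Hardy-Littlewood operator is $\mathcal{M}f(x)=\sup_{r>r_0}\frac{1}{|B_r|}\sum_{u:\,d(x,u)<r}|f(u)|$. *)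

theory Defs
  imports "HOL-Analysis.Analysis" "HOL-Algebra.Generated_Groups"
begin

definition finite_symmetric_generating_set :: "('a, 'b) monoid_scheme \<Rightarrow> 'a set \<Rightarrow> bool" where
  "finite_symmetric_generating_set G S \<longleftrightarrow>
     finite S \<and> S \<subseteq> carrier G \<and> (\<forall>s\<in>S. inv\<^bsub>G\<^esub> s \<in> S) \<and> generate G S = carrier G"

(* Since S is closed under inverses, words in S alone suffice.  The value is meaningful when S generates G. *)
definition word_length :: "('a, 'b) monoid_scheme \<Rightarrow> 'a set \<Rightarrow> 'a \<Rightarrow> nat" where
  "word_length G S g =
     (LEAST n. \<exists>ws. length ws = n \<and> set ws \<subseteq> S \<and> foldr (\<otimes>\<^bsub>G\<^esub>) ws \<one>\<^bsub>G\<^esub> = g)"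

definition word_dist :: "('a, 'b) monoid_scheme \<Rightarrow> 'a set \<Rightarrow> 'a \<Rightarrow> 'a \<Rightarrow> real" where
  "word_dist G S u v = real (word_length G S (inv\<^bsub>G\<^esub> u \<otimes>\<^bsub>G\<^esub> v))"

definition word_ball :: "('a, 'b) monoid_scheme \<Rightarrow> 'a set \<Rightarrow> real \<Rightarrow> 'a set" where
  "word_ball G S r = {g \<in> carrier G. real (word_length G S g) < r}"

definition gromov_product :: "('a \<Rightarrow> 'a \<Rightarrow> real) \<Rightarrow> 'a \<Rightarrow> 'a \<Rightarrow> 'a \<Rightarrow> real" where
  "gromov_product d w x y = (d x w + d y w - d x y) / 2"

definition gromov_hyperbolic :: "'a set \<Rightarrow> ('a \<Rightarrow> 'a \<Rightarrow> real) \<Rightarrow> bool" where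
  "gromov_hyperbolic M d \<longleftrightarrow>
     (\<exists>\<delta>\<ge>0. \<forall>w\<in>M. \<forall>x\<in>M. \<forall>y\<in>M. \<forall>z\<in>M.
        min (gromov_product d w x y) (gromov_product d w y z) - \<delta> \<le> gromov_product d w x z)"

(* Hyperbolicity is required for some word metric only; the generating set here is
   unrelated to any other generating set under consideration. *)
definition hyperbolic_group :: "('a, 'b) monoid_scheme \<Rightarrow> bool" where
  "hyperbolic_group G \<longleftrightarrow>
     group G \<and> (\<exists>T. finite_symmetric_generating_set G T \<and> gromov_hyperbolic (carrier G) (word_dist G T))"

(* Elementary means virtually cyclic; finite groups are included through the trivial subgroup. *)
definition elementary_group :: "('a, 'b) monoid_scheme \<Rightarrow> bool" where
  "elementary_group G \<longleftrightarrow>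
     (\<exists>g\<in>carrier G. finite (rcosets\<^bsub>G\<^esub> (generate G {g})))"

(* The supremum is taken in the extended reals, so that it is the true supremum for every f. *)
definition hardy_littlewood ::
  "('a, 'b) monoid_scheme \<Rightarrow> 'a set \<Rightarrow> real \<Rightarrow> ('a \<Rightarrow> complex) \<Rightarrow> 'a \<Rightarrow> ereal" where
  "hardy_littlewood G S r0 f x =
     (SUP r\<in>{r0<..}. ereal
        ((1 / real (card (word_ball G S r))) *
         (\<Sum>u\<in>{u \<in> carrier G. word_dist G S x u < r}. norm (f u))))"

end

theory Submission
  imports Defs
begin

text \<open>
  Write b(n) for the size of the closed n-ball of the word metric of S, which is again Gromov
  hyperbolic because hyperbolicity passes between bilipschitz graph metrics.

  If some finite set of translations a always moves a given direction h away from a given direction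
  g (so that the Gromov product of g and a h stays bounded), the sphere sizes satisfy
  s(i) s(j) \<le> K s(i + j). Otherwise there are points h far away which all a in a large ball move
  very little as seen from the identity; then d(x,h) - d(1,h) is a quasimorphism on that ball with
  fibres of bounded size, so b grows at most linearly. When b grows linearly, balls are doubling
  and the Vitali covering argument gives the weak type inequality.

  In the remaining case the s(i) are unbounded, so b(n) grows purely exponentially and we follow
  Naor and Tao: for finite sets X, E the number of pairs at distance at most k is
  O(sqrt (|X| |E| b(k))), since a pair at distance m is determined up to boundedly many choices by
  one end, a point at depth i towards the identity and one of b(m - i) points (or, from the
  other end, one of b(i) points). Decomposing f into level sets and summing over k
  with the Cauchy--Schwarz inequality yields the claim.
\<close>

section \<open>Graph metrics and quasi-isometry invariance\<close>

text \<open>The obstacle is the failure of doubling: under exponential growth, doubling a radius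
  roughly squares the volume, so covering arguments lose too much. The pair count replaces them. For
  sets X and E of equal size it improves the obvious bound |X| b(k) by a factor sqrt(b(k)). This
  gain needs b(i) b(m - i) to be at most a constant times b(m); knowing only the exponential rate of
  growth would not do. Such purely exponential growth is obtained here without boundary measures, by
  joining g and h through a connector a of bounded length that prevents backtracking. Connectors can
  fail to exist only when, seen from the identity, a large ball of translations hardly moves some
  far away direction; the group then looks like a line, and doubling is available after all.
  Hyperbolicity is given for one generating set and the balls for another. Large Gromov products are
  not comparable between the two metrics, so the transfer relies on bounded products only.\<close>

locale graph_metric =
  fixes M :: "'a set" and d :: "'a \<Rightarrow> 'a \<Rightarrow> nat"
  assumes refl [simp]: "x \<in> M \<Longrightarrow> d x x = 0"
    and eq: "\<lbrakk>x \<in> M; y \<in> M; d x y = 0\<rbrakk> \<Longrightarrow> x = y"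
    and sym: "\<lbrakk>x \<in> M; y \<in> M\<rbrakk> \<Longrightarrow> d x y = d y x"
    and tri: "\<lbrakk>x \<in> M; y \<in> M; z \<in> M\<rbrakk> \<Longrightarrow> d x z \<le> d x y + d y z"
    and interp: "\<lbrakk>x \<in> M; y \<in> M; m \<le> d x y\<rbrakk> \<Longrightarrow> \<exists>p\<in>M. d x p = m \<and> d p y = d x y - m"
begin

definition gp :: "'a \<Rightarrow> 'a \<Rightarrow> 'a \<Rightarrow> real" where
  "gp w x y = (real (d x w) + real (d y w) - real (d x y)) / 2"

text \<open>The constant is a natural number, so that it can be added to the integer radii of
  balls.\<close>

definition hyp :: "nat \<Rightarrow> bool" where
  "hyp \<delta> \<longleftrightarrow> (\<forall>w\<in>M. \<forall>x\<in>M. \<forall>y\<in>M. \<forall>z\<in>M. min (gp w x y) (gp w y z) - real \<delta> \<le> gp w x z)"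

lemma hypD:
  assumes "hyp \<delta>" "w \<in> M" "x \<in> M" "y \<in> M" "z \<in> M"
  shows "min (gp w x y) (gp w y z) - real \<delta> \<le> gp w x z"
  using assms unfolding hyp_def by blast

lemma hyp_four_point:
  assumes "hyp \<delta>" "w \<in> M" "x \<in> M" "y \<in> M" "z \<in> M"
  shows "d x z + d y w \<le> max (d x y + d z w) (d y z + d x w) + 2 * \<delta>"
proof -
  have "gp w x y - \<delta> \<le> gp w x z \<or> gp w y z - \<delta> \<le> gp w x z"
    using hypD[OF assms] by linarith
  then have "real (d x z + d y w) \<le> real (d x y + d z w + 2 * \<delta>) \<or>
      real (d x z + d y w) \<le> real (d y z + d x w + 2 * \<delta>)"
    unfolding gp_def by (simp add: field_simps) linarith
  then show ?thesis unfolding of_nat_le_iff by auto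
qed

lemma gromov_hyperbolic_iff:
  "gromov_hyperbolic M (\<lambda>x y. real (d x y)) \<longleftrightarrow> (\<exists>\<delta>. hyp \<delta>)"
proof
  assume "gromov_hyperbolic M (\<lambda>x y. real (d x y))"
  then obtain \<delta>::real where \<delta>: "\<And>w x y z. \<lbrakk>w \<in> M; x \<in> M; y \<in> M; z \<in> M\<rbrakk> \<Longrightarrow>
       min (gp w x y) (gp w y z) - \<delta> \<le> gp w x z"
    unfolding gromov_hyperbolic_def gromov_product_def gp_def by blast
  obtain k :: nat where k: "\<delta> \<le> k" using real_arch_simple by blast
  have "hyp k" unfolding hyp_def using \<delta> k by (smt (verit))
  then show "\<exists>\<delta>. hyp \<delta>" ..
next
  assume "\<exists>\<delta>. hyp \<delta>"
  then obtain \<delta> where "hyp \<delta>" ..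
  then show "gromov_hyperbolic M (\<lambda>x y. real (d x y))"
    unfolding gromov_hyperbolic_def hyp_def gp_def gromov_product_def
    by (intro exI[of _ "real \<delta>"]) simp
qed

lemma gp_nonneg: "\<lbrakk>w \<in> M; x \<in> M; y \<in> M\<rbrakk> \<Longrightarrow> 0 \<le> gp w x y"
  using tri[of x w y] sym[of y w] unfolding gp_def by simp

lemma gp_sym: "\<lbrakk>x \<in> M; y \<in> M\<rbrakk> \<Longrightarrow> gp w x y = gp w y x"
  using sym[of x y] unfolding gp_def by simp

lemma gp_le: "\<lbrakk>w \<in> M; x \<in> M; y \<in> M\<rbrakk> \<Longrightarrow> gp w x y \<le> d x w"
  using tri[of y x w] sym[of x y] unfolding gp_def by simp

text \<open>Cutting the chain in the middle costs one \<delta> per halving, so \<open>2 ^ m\<close>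
  links lose only \<open>m * \<delta>\<close>. Adding links one at a time would lose \<delta> for
  each of them, too much for the argument on geodesics below.\<close>

lemma gp_chain:
  assumes hyp: "hyp \<delta>" and w: "w \<in> M" and c: "\<And>i. i \<le> n \<Longrightarrow> c i \<in> M"
    and t: "\<And>i. i < n \<Longrightarrow> t \<le> gp w (c i) (c (Suc i))"
    and n: "0 < n" "n \<le> 2 ^ m"
  shows "t - real m * real \<delta> \<le> gp w (c 0) (c n)"
  using c t n
proof (induction m arbitrary: n c)
  case 0
  then have "n = 1" by simp
  then show ?case using "0.prems"(2)[of 0] by simp
next
  case (Suc m)
  show ?case
  proof (cases "n = 1")
    case True
    then show ?thesis using "Suc.prems"(2)[of 0]
      by simp (smt (verit) mult_nonneg_nonneg of_nat_0_le_iff)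
  next
    case False
    define k where "k = n div 2"
    have k: "0 < k" "k < n" "k \<le> 2 ^ m" "n - k \<le> 2 ^ m"
      using Suc.prems(3,4) False unfolding k_def by auto
    have 1: "t - real m * real \<delta> \<le> gp w (c 0) (c k)"
      using Suc.prems k by (intro Suc.IH) auto
    have "t - real m * real \<delta> \<le> gp w (c (0 + k)) (c ((n - k) + k))"
      using Suc.prems k by (intro Suc.IH[of "n - k" "\<lambda>i. c (i + k)"]) auto
    then have 2: "t - real m * real \<delta> \<le> gp w (c k) (c n)" using k by simp
    have "min (gp w (c 0) (c k)) (gp w (c k) (c n)) - real \<delta> \<le> gp w (c 0) (c n)"
      using Suc.prems(1) k by (intro hypD[OF hyp w]) auto
    then show ?thesis using 1 2 by (simp add: algebra_simps)
  qed
qed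

lemma geodesic_exists:
  assumes "x \<in> M" "y \<in> M"
  shows "\<exists>\<gamma>. \<gamma> 0 = x \<and> \<gamma> (d x y) = y \<and> (\<forall>i\<le>d x y. \<gamma> i \<in> M) \<and>
           (\<forall>i j. i \<le> j \<longrightarrow> j \<le> d x y \<longrightarrow> d (\<gamma> i) (\<gamma> j) = j - i)"
  using assms
proof (induction "d x y" arbitrary: y)
  case 0
  then have "x = y" using eq[of x y] by simp
  then show ?case using 0 by (intro exI[of _ "\<lambda>i. x"]) auto
next
  case (Suc n)
  obtain p where p: "p \<in> M" "d x p = n" "d p y = 1"
    using interp[OF Suc.prems, of n] Suc.hyps(2) by (metis add_diff_cancel_left' le_add1 plus_1_eq_Suc add.commute)
  obtain \<gamma> where \<gamma>: "\<gamma> 0 = x" "\<gamma> n = p" "\<And>i. i \<le> n \<Longrightarrow> \<gamma> i \<in> M"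
    "\<And>i j. i \<le> j \<Longrightarrow> j \<le> n \<Longrightarrow> d (\<gamma> i) (\<gamma> j) = j - i"
    using Suc.hyps(1)[of p] p Suc.prems by metis
  define \<gamma>' where "\<gamma>' = \<gamma>(Suc n := y)"
  have "d (\<gamma> i) y = Suc n - i" if "i \<le> n" for i
  proof -
    have "d (\<gamma> i) y \<le> (n - i) + 1" using tri[of "\<gamma> i" p y] \<gamma>(3)[OF that] p \<gamma>(2) \<gamma>(4)[of i n] that Suc.prems by simp
    moreover have "Suc n \<le> i + d (\<gamma> i) y"
      using tri[of x "\<gamma> i" y] \<gamma>(1,3) \<gamma>(4)[of 0 i] that Suc.prems Suc.hyps(2) by simp
    ultimately show ?thesis using that by simp
  qed
  then show ?case unfolding Suc.hyps(2)[symmetric]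
    using \<gamma> Suc.prems by (intro exI[of _ \<gamma>']) (auto simp: \<gamma>'_def le_Suc_eq)
qed

text \<open>The point q is the integer version of the centre of the tripod with ends x, y, p: it has
  depth \<open>gp x p y\<close> rounded down, and the rounding accounts for the +1. Hyperbolicity at
  x and at y says that the routes from there to p and to q coincide almost up to q. The distance
  bound places points with small product near an interval; the last two bounds serve the transfer of
  hyperbolicity.\<close>

lemma near_interval:
  assumes hyp: "hyp \<delta>" and M: "x \<in> M" "y \<in> M" "p \<in> M"
  shows "\<exists>q\<in>M. d x q + d q y = d x y \<and> real (d p q) \<le> gp p x y + 1 + 2 * real \<delta>
     \<and> gp q p x \<le> real \<delta> + 1 \<and> gp q p y \<le> real \<delta> + 1"
proof -
  define s where "s = nat \<lfloor>gp x p y\<rfloor>"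
  have s: "real s \<le> gp x p y" "gp x p y < s + 1"
    using gp_nonneg[of x p y] M unfolding s_def by linarith+
  have "gp x p y \<le> d x y" using gp_le[of x y p] gp_sym[of y p x] sym[of x y] M by simp
  then have "s \<le> d x y" using s by linarith
  then obtain q where q: "q \<in> M" "d x q = s" "d q y = d x y - s" using interp[of x y s] M by blast
  have dxy: "real (d x y) = s + real (d q y)" using q \<open>s \<le> d x y\<close> by simp
  have 1: "min (gp x p y) (gp x y q) - real \<delta> \<le> gp x p q" using hypD[OF hyp] M q(1) by blast
  have 2: "min (gp y p x) (gp y x q) - real \<delta> \<le> gp y p q" using hypD[OF hyp] M q(1) by blast
  note sy = sym[OF M(3,1)] sym[OF M(3,2)] sym[OF q(1) M(1)] sym[OF q(1) M(2)] sym[OF M(3) q(1)] sym[OF M(1,2)]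
  have "gp x y q = s" using sy dxy q unfolding gp_def by simp
  then have 3: "s - real \<delta> \<le> gp x p q" using 1 s by simp
  have "gp y x q = d q y" using sy dxy q unfolding gp_def by simp
  moreover have "gp y p x \<le> d q y" using sy dxy s unfolding gp_def by (simp add: field_simps)
  ultimately have 4: "gp y p x - real \<delta> \<le> gp y p q" using 2 by simp
  have "real (d p q) \<le> gp p x y + 1 + 2 * real \<delta>" "gp q p x \<le> real \<delta> + 1"  "gp q p y \<le> real \<delta> + 1"
    using 3 4 dxy q(2) s sy unfolding gp_def by (simp_all add: field_simps)
  then show ?thesis using q \<open>s \<le> d x y\<close> by (intro bexI[of _ q]) auto
qed

end

section \<open>Bilipschitz invariance of hyperbolicity\<close>

lemma linear_le_two_power:
  fixes a b m :: nat
  assumes "a + b + 4 \<le> m"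
  shows "a * m + b \<le> 2 ^ m"
proof -
  have "4 \<le> m" using assms by simp
  then have "m\<^sup>2 \<le> 2 ^ m"
  proof (induction m rule: nat_induct_at_least)
    case base show ?case by simp
  next
    case (Suc n)
    then have "2 * n + 1 \<le> n * n" using mult_le_mono1[of 4 n n] by linarith
    then show ?case using Suc by (simp add: power2_eq_square)
  qed
  moreover have "a * m + b \<le> m * m"
  proof -
    have "a * m + b \<le> a * m + b * m" using assms by simp
    also have "\<dots> = (a + b) * m" by (simp add: algebra_simps)
    also have "\<dots> \<le> m * m" using assms by (intro mult_le_mono1) simp
    finally show ?thesis .
  qed
  ultimately show ?thesis by (simp add: power2_eq_square)
qed

locale bilipschitz_graph_metrics = T: graph_metric M d' + graph_metric M d
  for M :: "'a set" and d' d :: "'a \<Rightarrow> 'a \<Rightarrow> nat" +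
  fixes L :: nat
  assumes lip': "\<lbrakk>x \<in> M; y \<in> M\<rbrakk> \<Longrightarrow> d' x y \<le> L * d x y"
    and lip: "\<lbrakk>x \<in> M; y \<in> M\<rbrakk> \<Longrightarrow> d x y \<le> L * d' x y"
begin

text \<open>
  The half of the Morse lemma that suffices here. Let u on the d'-interval from x to y be as far
  as possible from a d-geodesic, say at distance D. Going at most 2 D from u to either side, then at most D
  to the geodesic, and along the geodesic gives a chain of O(D) steps staying D away from u that joins two points
  with Gromov product 0 at u; halving chains shows that this costs only O(log D), so D is bounded.
\<close>

lemma interval_near_geodesic:
  assumes hyp: "T.hyp \<delta>"
  shows "\<exists>D. \<forall>x\<in>M. \<forall>y\<in>M. \<forall>p\<in>M. d' x p + d' p y = d' x y \<longrightarrow>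
           (\<exists>q\<in>M. d x q + d q y = d x y \<and> d' p q \<le> D)"
proof -
  \<comment> \<open>The detour below has length at most \<open>6 * D\<close> (twice
    \<open>2 * D\<close> and twice D), hence spans at most \<open>6 * L * D\<close> geodesic steps.
    Inserting \<open>D \<le> L + 1 + (m + 3) * (\<delta> + 1)\<close> there gives exactly
    \<open>a * m + b\<close>, and D0 is large enough to force
    \<open>a + b + 4 \<le> m\<close>.\<close>
  define a b where "a = 6 * L * (\<delta> + 1)" and "b = 6 * L * (L + 1 + 3 * (\<delta> + 1))"
  define D0 where "D0 = L + 1 + (a + b + 8) * (\<delta> + 1)"
  have "\<exists>q\<in>M. d x q + d q y = d x y \<and> d' p q \<le> D0"
    if M: "x \<in> M" "y \<in> M" "p \<in> M" and p: "d' x p + d' p y = d' x y" for x y p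
  proof -
    obtain \<gamma> where \<gamma>: "\<gamma> 0 = x" "\<gamma> (d x y) = y" "\<And>i. i \<le> d x y \<Longrightarrow> \<gamma> i \<in> M"
      "\<And>i j. i \<le> j \<Longrightarrow> j \<le> d x y \<Longrightarrow> d (\<gamma> i) (\<gamma> j) = j - i"
      using geodesic_exists[OF M(1,2)] by blast
    define n where "n = d x y"
    note \<gamma> = \<gamma>[folded n_def]
    define e where "e u = Min ((\<lambda>i. d' u (\<gamma> i)) ` {..n})" for u
    have e_le: "e u \<le> d' u (\<gamma> i)" if "i \<le> n" for u i
      unfolding e_def using that by (intro Min_le) auto
    have e_attained: "\<exists>i\<le>n. d' u (\<gamma> i) = e u" for u
    proof -
      have "e u \<in> (\<lambda>i. d' u (\<gamma> i)) ` {..n}" unfolding e_def by (intro Min_in) auto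
      then show ?thesis by auto
    qed
    define I where "I = {p \<in> M. d' x p + d' p y = d' x y}"
    have "e u \<le> d' x y" if "u \<in> I" for u
      using e_le[of 0 u] that T.sym[of u x] M \<gamma>(1) unfolding I_def by auto
    moreover have "p \<in> I" using M p by (simp add: I_def)
    ultimately obtain u where u: "u \<in> I" "\<And>v. v \<in> I \<Longrightarrow> e v \<le> e u"
      using ex_has_greatest_nat[of "\<lambda>u. u \<in> I" p e "Suc (d' x y)"] by (metis le_imp_less_Suc)
    define D where "D = e u"
    have uM: "u \<in> M" "d' x u + d' u y = d' x y" using u(1) by (auto simp: I_def)
    \<comment> \<open>The distance \<open>2 * D\<close> makes the product at u of v and its foot at
      least \<open>(2 * D + D - D) / 2 = D\<close>. If the end a is already within
      \<open>2 * D\<close> of u, then v is a itself, which lies on the geodesic.\<close>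
    have side: "\<exists>v i. v \<in> M \<and> i \<le> n \<and> d' a v + d' v u = d' a u \<and> D \<le> T.gp u v (\<gamma> i) \<and> d' u v \<le> 2 * D \<and> d' v (\<gamma> i) \<le> D"
      if a: "(a = x \<and> b = y) \<or> (a = y \<and> b = x)" for a b
    proof -
      have ab: "a \<in> M" "b \<in> M" using a M by auto
      obtain k where k: "k \<le> n" "\<gamma> k = a" using a \<gamma>(1,2) by auto
      have aub: "d' a u + d' u b = d' a b" 
        using a uM T.sym[OF M(1,2)] T.sym[OF M(1) uM(1)] T.sym[OF uM(1) M(2)] by auto
      show ?thesis
      proof (cases "d' u a \<le> 2 * D")
        case True
        have "T.gp u a a = d' a u" unfolding T.gp_def using ab by simp
        also have "\<dots> \<ge> D" using e_le[OF k(1), of u] T.sym[OF ab(1) uM(1)] unfolding D_def k(2) by simp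
        finally show ?thesis using k ab True by (intro exI[of _ a] exI[of _ k]) (auto simp: D_def)
      next
        case False
        then obtain v where v: "v \<in> M" "d' u v = 2 * D" "d' v a = d' u a - 2 * D"
          using T.interp[OF uM(1) ab(1), of "2 * D"] by auto
        have eq: "d' a v + d' v u = d' a u"
          using v False T.sym[OF ab(1) v(1)] T.sym[OF ab(1) uM(1)] T.sym[OF v(1) uM(1)] by simp
        have "d' a v + d' v b = d' a b"
          using T.tri[OF ab(1) v(1) ab(2)] T.tri[OF v(1) uM(1) ab(2)] eq aub by simp
        then have "v \<in> I" unfolding I_def using v(1) a
            T.sym[OF v(1) M(1)] T.sym[OF v(1) M(2)] T.sym[OF M(1,2)] by auto
        then have "e v \<le> D" using u(2) D_def by simp
        moreover obtain i where i: "i \<le> n" "d' v (\<gamma> i) = e v" using e_attained by blast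
        moreover have "D \<le> d' u (\<gamma> i)" using e_le[OF i(1)] D_def by simp
        moreover have "\<gamma> i \<in> M" using i \<gamma> by simp
        ultimately have "D \<le> T.gp u v (\<gamma> i)" unfolding T.gp_def
          using v T.sym[OF v(1) uM(1)] T.sym[OF \<open>\<gamma> i \<in> M\<close> uM(1)] by simp
        then show ?thesis using v eq i \<open>e v \<le> D\<close> by (intro exI[of _ v] exI[of _ i]) simp
      qed
    qed
    obtain v i where v: "v \<in> M" "i \<le> n" "d' x v + d' v u = d' x u" "D \<le> T.gp u v (\<gamma> i)"
        "d' u v \<le> 2 * D" "d' v (\<gamma> i) \<le> D"
      using side by blast
    obtain w j where w: "w \<in> M" "j \<le> n" "d' y w + d' w u = d' y u" "D \<le> T.gp u w (\<gamma> j)"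
        "d' u w \<le> 2 * D" "d' w (\<gamma> j) \<le> D"
      using side by blast
    have \<gamma>M: "\<gamma> i \<in> M" "\<gamma> j \<in> M" using v w \<gamma> by auto
    have "T.gp u v w = 0"
    proof -
      have "d' x y \<le> d' x v + d' v w + d' w y"
        using T.tri[OF M(1) v(1) M(2)] T.tri[OF v(1) w(1) M(2)] by simp
      then have "d' v u + d' w u \<le> d' v w"
        using v(3) w(3) uM(2) T.sym[OF w(1) M(2)] T.sym[OF uM(1) M(2)] by simp
      moreover have "d' v w \<le> d' v u + d' w u" using T.tri[OF v(1) uM(1) w(1)] T.sym[OF uM(1) w(1)] by simp
      ultimately show ?thesis unfolding T.gp_def by simp
    qed
    have "D \<le> D0"
    proof (rule ccontr)
      assume "\<not> D \<le> D0"
      \<comment> \<open>About \<open>D / (\<delta> + 1)\<close>: large enough for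
        \<open>2 ^ m\<close> to bound the number of steps, small enough for the total loss to stay
        below D. Of the \<open>m + 2\<close> losses of \<delta>, m come from the chain along the
        geodesic and two from attaching v and w.\<close>
      define m where "m = (D - L - 1) div (\<delta> + 1) - 2"
      have D: "D > L + 1 + (a + b + 8) * (\<delta> + 1)" using \<open>\<not> D \<le> D0\<close> D0_def by simp
      then have "(a + b + 8) * (\<delta> + 1) \<le> D - L - 1" by linarith
      then have "a + b + 8 \<le> (D - L - 1) div (\<delta> + 1)"
        by (simp add: less_eq_div_iff_mult_less_eq)
      then have m: "a + b + 4 \<le> m" "m + 2 = (D - L - 1) div (\<delta> + 1)" unfolding m_def by simp_all
      have "(m + 2) * (\<delta> + 1) \<le> D - L - 1" unfolding m(2) by (rule div_times_less_eq_dividend)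
      then have mD: "L + (m + 2) * \<delta> < D" using D by (simp add: algebra_simps)
      have "D - L - 1 < (m + 3) * (\<delta> + 1)" using m(2)
        by (metis Suc_eq_plus1 add.commute add_2_eq_Suc' dividend_less_times_div eval_nat_numeral(3) mult.commute mult_Suc_right zero_less_Suc add_Suc_right)
      then have "D \<le> L + 1 + (m + 3) * (\<delta> + 1)" using D by linarith
      then have "6 * L * D \<le> 6 * L * (L + 1 + (m + 3) * (\<delta> + 1))" by simp
      also have "\<dots> = a * m + b" unfolding a_def b_def by (simp add: algebra_simps)
      also have "\<dots> \<le> 2 ^ m" using m(1) by (rule linear_le_two_power)
      finally have LD: "6 * L * D \<le> 2 ^ m" .
      have step: "real D - L \<le> T.gp u (\<gamma> k) (\<gamma> (Suc k))" if "k < n" for k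
      proof -
        have kM: "\<gamma> k \<in> M" "\<gamma> (Suc k) \<in> M" using that \<gamma>(3) by auto
        have "d' (\<gamma> k) (\<gamma> (Suc k)) \<le> L" using lip'[OF kM] \<gamma>(4)[of k "Suc k"] that by simp
        moreover have "D \<le> d' (\<gamma> k) u" "D \<le> d' (\<gamma> (Suc k)) u"
          using e_le[of k u] e_le[of "Suc k" u] that T.sym[OF kM(1) uM(1)] T.sym[OF kM(2) uM(1)] D_def by auto
        ultimately show ?thesis unfolding T.gp_def by (simp add: field_simps)
      qed
      have mid: "real D - L - real m * \<delta> \<le> T.gp u (\<gamma> i') (\<gamma> j')"
        if ij: "i' \<le> j'" "j' \<le> n" "d' (\<gamma> i') (\<gamma> j') \<le> 6 * D" for i' j'
      proof (cases "i' = j'")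
        case True
        have "\<gamma> j' \<in> M" using ij \<gamma> by simp
        then have "D \<le> T.gp u (\<gamma> i') (\<gamma> j')" unfolding True T.gp_def
          using e_le[of j' u] ij T.sym[of "\<gamma> j'" u] uM(1) D_def by simp
        moreover have "0 \<le> real m * real \<delta>" by simp
        ultimately show ?thesis by linarith
      next
        case False
        have "j' - i' \<le> L * d' (\<gamma> i') (\<gamma> j')"
          using lip[of "\<gamma> i'" "\<gamma> j'"] \<gamma>(3,4) ij by simp
        also have "\<dots> \<le> L * (6 * D)" using ij(3) by (rule mult_le_mono2)
        also have "\<dots> \<le> 2 ^ m" using LD by (simp add: ac_simps)
        finally have "j' - i' \<le> 2 ^ m" .
        then have "real D - L - real m * \<delta> \<le> T.gp u (\<gamma> (0 + i')) (\<gamma> (j' - i' + i'))"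
          using ij False \<gamma>(3) step uM(1)
          by (intro T.gp_chain[OF hyp, of u "j' - i'" "\<lambda>k. \<gamma> (k + i')"]) auto
        then show ?thesis using ij by simp
      qed
      have "d' (\<gamma> i) (\<gamma> j) \<le> 6 * D"
      proof -
        have "d' (\<gamma> i) (\<gamma> j) \<le> d' (\<gamma> i) v + d' v u + d' u w + d' w (\<gamma> j)"
          using T.tri[OF \<gamma>M(1) v(1) \<gamma>M(2)] T.tri[OF v(1) uM(1) \<gamma>M(2)] T.tri[OF uM(1) w(1) \<gamma>M(2)] by simp
        then show ?thesis using v(5,6) w(5,6) T.sym[OF \<gamma>M(1) v(1)] T.sym[OF v(1) uM(1)] by simp
      qed
      then have "real D - L - real m * \<delta> \<le> T.gp u (\<gamma> i) (\<gamma> j)"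
        using mid[of i j] mid[of j i] v(2) w(2) T.sym[OF \<gamma>M] T.gp_sym[OF \<gamma>M, of u] by (cases "i \<le> j") auto
      moreover have "min (T.gp u v (\<gamma> i)) (T.gp u (\<gamma> i) (\<gamma> j)) - \<delta> \<le> T.gp u v (\<gamma> j)"
        using T.hypD[OF hyp] uM(1) v(1) \<gamma>M by blast
      moreover have "min (T.gp u v (\<gamma> j)) (T.gp u (\<gamma> j) w) - \<delta> \<le> T.gp u v w"
        using T.hypD[OF hyp] uM(1) v(1) w(1) \<gamma>M by blast
      moreover have "D \<le> T.gp u (\<gamma> j) w" using w(4) T.gp_sym[OF w(1) \<gamma>M(2)] by simp
      moreover have "real L + real m * \<delta> + 2 * \<delta> < D"
        using mD by (metis (mono_tags, lifting) add.assoc distrib_right of_nat_add of_nat_less_iff of_nat_mult of_nat_numeral)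
      moreover have "0 \<le> real m * real \<delta>" by simp
      ultimately show False using v(4) \<open>T.gp u v w = 0\<close> by linarith
    qed
    moreover obtain k where k: "k \<le> n" "d' p (\<gamma> k) = e p" using e_attained by blast
    moreover have "e p \<le> D" using u(2) \<open>p \<in> I\<close> D_def by simp
    moreover have "d x (\<gamma> k) + d (\<gamma> k) y = d x y"
      using \<gamma>(1,2) \<gamma>(4)[of 0 k] \<gamma>(4)[of k n] k(1) by (simp add: n_def)
    ultimately show ?thesis using \<gamma>(3)[of k] by (intro bexI[of _ "\<gamma> k"]) auto
  qed
  then show ?thesis by blast
qed

text \<open>A small product at p means that p is near an interval, a property that survives the
  change of metric. Conversely, a product is at most the distance from p to any point of the
  interval.\<close>

lemma gp_le_if_T_gp_le:
  assumes hyp: "T.hyp \<delta>"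
  shows "\<exists>K. \<forall>x\<in>M. \<forall>y\<in>M. \<forall>p\<in>M. T.gp p x y \<le> real k \<longrightarrow> gp p x y \<le> real K"
proof -
  obtain D where D: "\<And>x y q. \<lbrakk>x \<in> M; y \<in> M; q \<in> M; d' x q + d' q y = d' x y\<rbrakk> \<Longrightarrow>
           \<exists>r\<in>M. d x r + d r y = d x y \<and> d' q r \<le> D"
    using interval_near_geodesic[OF hyp] by blast
  have "gp p x y \<le> real (L * (k + 1 + 2 * \<delta> + D))"
    if M: "x \<in> M" "y \<in> M" "p \<in> M" and p: "T.gp p x y \<le> real k" for x y p
  proof -
    obtain q where q: "q \<in> M" "d' x q + d' q y = d' x y" "real (d' p q) \<le> T.gp p x y + 1 + 2 * real \<delta>"
      using T.near_interval[OF hyp M] by blast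
    obtain r where r: "r \<in> M" "d x r + d r y = d x y" "d' q r \<le> D" using D[OF M(1,2) q(1,2)] by blast
    have "d' p q \<le> k + 1 + 2 * \<delta>" using q(3) p by linarith
    then have "d' p r \<le> k + 1 + 2 * \<delta> + D" using T.tri[OF M(3) q(1) r(1)] r(3) by simp
    then have "d p r \<le> L * (k + 1 + 2 * \<delta> + D)"
      using lip[OF M(3) r(1)] by (meson le_trans mult_le_mono2)
    moreover have "gp p x y \<le> d p r" unfolding gp_def
      using tri[OF M(1) r(1) M(3)] tri[OF M(2) r(1) M(3)] r(2) sym[OF r(1) M(3)] sym[OF r(1) M(2)] by simp
    ultimately show ?thesis by (meson of_nat_le_iff order_trans)
  qed
  then show ?thesis by blast
qed

text \<open>Everything is measured from the centre q of the tripod for \<open>d'\<close> on w, x, z,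
  where the relevant products are bounded. In d, \<open>gp w x z\<close> is then at least
  \<open>d w q\<close> up to \<open>2 * K1\<close>. Hyperbolicity of \<open>d'\<close> at q, where x
  and z have product 0, makes one of \<open>gp w x y\<close> and \<open>gp w y z\<close> at most
  \<open>d w q + K2\<close>.\<close>

theorem hyp_transfer:
  assumes hyp: "T.hyp \<delta>"
  shows "\<exists>\<epsilon>. hyp \<epsilon>"
proof -
  obtain K1 where K1: "\<And>x y p. \<lbrakk>x \<in> M; y \<in> M; p \<in> M; T.gp p x y \<le> real (\<delta> + 1)\<rbrakk> \<Longrightarrow> gp p x y \<le> real K1"
    using gp_le_if_T_gp_le[OF hyp, of "\<delta> + 1"] by blast
  obtain K2 where K2: "\<And>x y p. \<lbrakk>x \<in> M; y \<in> M; p \<in> M; T.gp p x y \<le> real \<delta>\<rbrakk> \<Longrightarrow> gp p x y \<le> real K2"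
    using gp_le_if_T_gp_le[OF hyp, of \<delta>] by blast
  have "min (gp w x y) (gp w y z) - real (2 * K1 + K2) \<le> gp w x z"
    if M: "w \<in> M" "x \<in> M" "y \<in> M" "z \<in> M" for w x y z
  proof -
    obtain q where q: "q \<in> M" "d' x q + d' q z = d' x z"
      "T.gp q w x \<le> real \<delta> + 1" "T.gp q w z \<le> real \<delta> + 1"
      using T.near_interval[OF hyp M(2,4,1)] by blast
    have "gp q w x \<le> K1" "gp q w z \<le> K1" using K1 q M by auto
    then have 1: "d w q - 2 * real K1 \<le> gp w x z"
      using tri[OF M(2) q(1) M(4)] sym[OF M(1,2)] sym[OF M(1,4)] sym[OF q(1) M(4)] unfolding gp_def by (simp add: field_simps)
    have "T.gp q x z = 0" using q(2) T.sym[OF q(1) M(4)] unfolding T.gp_def by simp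
    then have "T.gp q x y \<le> \<delta> \<or> T.gp q y z \<le> \<delta>" using T.hypD[OF hyp q(1) M(2,3,4)] by linarith
    then have "gp q x y \<le> K2 \<or> gp q y z \<le> K2" using K2 q M by auto
    moreover have "gp w x y \<le> d w q + gp q x y"
      using tri[OF M(2) q(1) M(1)] tri[OF M(3) q(1) M(1)] sym[OF M(1) q(1)] unfolding gp_def by (simp add: field_simps)
    moreover have "gp w y z \<le> d w q + gp q y z"
      using tri[OF M(4) q(1) M(1)] tri[OF M(3) q(1) M(1)] sym[OF M(1) q(1)] unfolding gp_def by (simp add: field_simps)
    ultimately show ?thesis using 1 by simp linarith
  qed
  then show ?thesis unfolding hyp_def by blast
qed

end

section \<open>Word metrics\<close>

locale word_metric = group G for G :: "('a, 'b) monoid_scheme" (structure) +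
  fixes S :: "'a set"
  assumes gen: "finite_symmetric_generating_set G S"
begin

abbreviation len :: "'a \<Rightarrow> nat" where "len \<equiv> word_length G S"

abbreviation word_prod :: "'a list \<Rightarrow> 'a" where "word_prod ws \<equiv> foldr (\<otimes>) ws \<one>"

definition dst :: "'a \<Rightarrow> 'a \<Rightarrow> nat" where "dst u v = len (inv u \<otimes> v)"

definition cb :: "nat \<Rightarrow> 'a set" where "cb n = {g \<in> carrier G. len g \<le> n}"

lemma gens: "finite S" "S \<subseteq> carrier G" "s \<in> S \<Longrightarrow> inv s \<in> S" "generate G S = carrier G"
  using gen unfolding finite_symmetric_generating_set_def by auto

lemma word_prod_closed [simp]: "set ws \<subseteq> S \<Longrightarrow> word_prod ws \<in> carrier G"
  by (induction ws) (use gens in auto)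

lemma word_prod_append:
  "\<lbrakk>set xs \<subseteq> S; set ys \<subseteq> S\<rbrakk> \<Longrightarrow> word_prod (xs @ ys) = word_prod xs \<otimes> word_prod ys"
proof (induction xs)
  case (Cons a xs)
  then have "a \<in> carrier G" using gens by auto
  then show ?case using Cons by (simp add: m_assoc del: foldr_append)
qed simp

lemma word_exists:
  assumes "g \<in> carrier G"
  shows "\<exists>ws. set ws \<subseteq> S \<and> word_prod ws = g"
proof -
  have "g \<in> generate G S" using assms gens by simp
  then show ?thesis
  proof (induction rule: generate.induct)
    case one then show ?case by (intro exI[of _ "[]"]) simp
  next
    case (incl h) then show ?case using gens by (intro exI[of _ "[h]"]) auto
  next
    case (inv h)
    then have "inv h \<in> S" "inv h \<in> carrier G" using gens by auto
    then show ?case by (intro exI[of _ "[inv h]"]) auto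
  next
    case (eng h1 h2)
    then obtain xs ys where "set xs \<subseteq> S" "word_prod xs = h1" "set ys \<subseteq> S" "word_prod ys = h2" by blast
    then show ?case by (intro exI[of _ "xs @ ys"]) (simp add: word_prod_append del: foldr_append)
  qed
qed

lemma len_le: "set ws \<subseteq> S \<Longrightarrow> len (word_prod ws) \<le> length ws"
  unfolding word_length_def by (rule Least_le) auto

lemma len_witness:
  assumes "g \<in> carrier G"
  shows "\<exists>ws. length ws = len g \<and> set ws \<subseteq> S \<and> word_prod ws = g"
proof -
  have "\<exists>n ws. length ws = n \<and> set ws \<subseteq> S \<and> word_prod ws = g" using word_exists[OF assms] by auto
  then show ?thesis unfolding word_length_def by (rule LeastI_ex)
qed

lemma len_one [simp]: "len \<one> = 0"
  using len_le[of "[]"] by simp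

lemma len_eq_0: "\<lbrakk>g \<in> carrier G; len g = 0\<rbrakk> \<Longrightarrow> g = \<one>"
  using len_witness[of g] by auto

lemma len_mult: "\<lbrakk>g \<in> carrier G; h \<in> carrier G\<rbrakk> \<Longrightarrow> len (g \<otimes> h) \<le> len g + len h"
proof -
  assume "g \<in> carrier G" "h \<in> carrier G"
  then obtain xs ys where "length xs = len g" "set xs \<subseteq> S" "word_prod xs = g"
    "length ys = len h" "set ys \<subseteq> S" "word_prod ys = h" using len_witness by meson
  then show ?thesis using len_le[of "xs @ ys"] word_prod_append[of xs ys] by (simp del: foldr_append)
qed

lemma inv_word_prod: "set ws \<subseteq> S \<Longrightarrow> \<exists>vs. length vs = length ws \<and> set vs \<subseteq> S \<and> word_prod vs = inv (word_prod ws)"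
proof (induction ws)
  case (Cons a ws)
  then obtain vs where vs: "length vs = length ws" "set vs \<subseteq> S" "word_prod vs = inv (word_prod ws)" by auto
  have a: "a \<in> carrier G" "inv a \<in> S" using Cons gens by auto
  have "word_prod (vs @ [inv a]) = inv (word_prod ws) \<otimes> inv a"
    using vs a by (subst word_prod_append) auto
  also have "\<dots> = inv (word_prod (a # ws))" using a Cons.prems by (simp add: inv_mult_group)
  finally show ?case using vs a by (intro exI[of _ "vs @ [inv a]"]) auto
qed simp

lemma len_inv_le: "g \<in> carrier G \<Longrightarrow> len (inv g) \<le> len g"
proof -
  assume "g \<in> carrier G"
  then obtain ws where ws: "length ws = len g" "set ws \<subseteq> S" "word_prod ws = g" using len_witness by blast
  obtain vs where "length vs = length ws" "set vs \<subseteq> S" "word_prod vs = inv (word_prod ws)"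
    using inv_word_prod[OF ws(2)] by blast
  then show ?thesis using len_le[of vs] ws by simp
qed

lemma len_inv [simp]: "g \<in> carrier G \<Longrightarrow> len (inv g) = len g"
  using len_inv_le[of g] len_inv_le[of "inv g"] by simp

lemma len_split:
  assumes g: "g \<in> carrier G" and m: "m \<le> len g"
  shows "\<exists>p\<in>carrier G. len p = m \<and> len (inv p \<otimes> g) = len g - m"
proof -
  obtain ws where ws: "length ws = len g" "set ws \<subseteq> S" "word_prod ws = g" using len_witness[OF g] by blast
  define p q where "p = word_prod (take m ws)" and "q = word_prod (drop m ws)"
  have S: "set (take m ws) \<subseteq> S" "set (drop m ws) \<subseteq> S"
    using ws(2) set_take_subset set_drop_subset by fast+
  have pq: "p \<in> carrier G" "q \<in> carrier G" using S by (auto simp: p_def q_def)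
  have "p \<otimes> q = g" using word_prod_append[OF S] ws(3) by (simp add: p_def q_def)
  moreover have "len p \<le> m" "len q \<le> len g - m"
    using len_le[OF S(1)] len_le[OF S(2)] ws(1) m by (auto simp: p_def q_def)
  moreover have "len g \<le> len p + len q" using len_mult[OF pq] \<open>p \<otimes> q = g\<close> by simp
  moreover have "inv p \<otimes> g = q" using pq by (simp flip: \<open>p \<otimes> q = g\<close> m_assoc)
  ultimately show ?thesis using pq m by (intro bexI[of _ p]) auto
qed

lemma finite_cb [simp]: "finite (cb n)"
proof (rule finite_subset)
  show "cb n \<subseteq> word_prod ` {ws. set ws \<subseteq> S \<and> length ws \<le> n}"
    proof
    fix g assume "g \<in> cb n"
    then obtain ws where "length ws = len g" "set ws \<subseteq> S" "word_prod ws = g" "len g \<le> n"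
      using len_witness[of g] unfolding cb_def by auto
    then show "g \<in> word_prod ` {ws. set ws \<subseteq> S \<and> length ws \<le> n}" by auto
  qed
  show "finite (word_prod ` {ws. set ws \<subseteq> S \<and> length ws \<le> n})"
    using finite_lists_length_le[OF gens(1)] by blast
qed

lemma cb_carrier: "cb n \<subseteq> carrier G"
  unfolding cb_def by auto

lemma dst_left_mult: "\<lbrakk>g \<in> carrier G; u \<in> carrier G; v \<in> carrier G\<rbrakk> \<Longrightarrow> dst (g \<otimes> u) (g \<otimes> v) = dst u v"
proof -
  assume a: "g \<in> carrier G" "u \<in> carrier G" "v \<in> carrier G"
  then have "inv (g \<otimes> u) \<otimes> (g \<otimes> v) = inv u \<otimes> (inv g \<otimes> (g \<otimes> v))" by (simp add: inv_mult_group m_assoc)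
  also have "inv g \<otimes> (g \<otimes> v) = v" using a by (simp flip: m_assoc)
  finally show ?thesis unfolding dst_def by simp
qed

lemma dst_one [simp]: "g \<in> carrier G \<Longrightarrow> dst \<one> g = len g"
  unfolding dst_def by simp

lemma dst_sym: "\<lbrakk>u \<in> carrier G; v \<in> carrier G\<rbrakk> \<Longrightarrow> dst u v = dst v u"
  unfolding dst_def using len_inv[of "inv u \<otimes> v"] by (simp add: inv_mult_group)

lemma dst_one_right [simp]: "g \<in> carrier G \<Longrightarrow> dst g \<one> = len g"
  using dst_sym[of g \<one>] by simp

sublocale graph_metric "carrier G" dst
proof
  fix x y z m
  assume x: "x \<in> carrier G"
  show "dst x x = 0" using x by (simp add: dst_def)
  assume y: "y \<in> carrier G"
  show "dst x y = dst y x" using x y by (rule dst_sym)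
  show "x = y" if "dst x y = 0"
  proof -
    have "inv x \<otimes> y = \<one>" using len_eq_0[of "inv x \<otimes> y"] x y that unfolding dst_def by simp
    then have "x \<otimes> (inv x \<otimes> y) = x" using x by simp
    then show ?thesis using x y by (simp flip: m_assoc)
  qed
  show "\<exists>p\<in>carrier G. dst x p = m \<and> dst p y = dst x y - m" if m: "m \<le> dst x y"
  proof -
    obtain p where p: "p \<in> carrier G" "len p = m" "len (inv p \<otimes> (inv x \<otimes> y)) = dst x y - m"
      using len_split[of "inv x \<otimes> y" m] m x y unfolding dst_def by auto
    have "dst x (x \<otimes> p) = m" using dst_left_mult[of x \<one> p] x p by simp
    moreover have "dst (x \<otimes> p) y = dst x y - m"
      using p x y by (simp add: dst_def inv_mult_group m_assoc)
    ultimately show ?thesis using x p by (intro bexI[of _ "x \<otimes> p"]) auto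
  qed
  assume z: "z \<in> carrier G"
  have "inv x \<otimes> z = (inv x \<otimes> y) \<otimes> (inv y \<otimes> z)" 
  proof -
    have "(inv x \<otimes> y) \<otimes> (inv y \<otimes> z) = inv x \<otimes> (y \<otimes> (inv y \<otimes> z))" using x y z by (simp add: m_assoc)
    also have "y \<otimes> (inv y \<otimes> z) = z" using y z by (simp flip: m_assoc)
    finally show ?thesis by simp
  qed
  then show "dst x z \<le> dst x y + dst y z" unfolding dst_def using len_mult[of "inv x \<otimes> y" "inv y \<otimes> z"] x y z by simp
qed

lemma word_dist_eq: "word_dist G S u v = real (dst u v)"
  unfolding word_dist_def dst_def ..

text \<open>Each letter of S is rewritten as a word in T, and L is the longest length that occurs;
  the inserted 0 keeps the maximum defined for empty S.\<close>

lemma len_bilipschitz: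
  assumes "word_metric G T"
  shows "\<exists>L. \<forall>g\<in>carrier G. word_length G T g \<le> L * len g"
proof -
  interpret T: word_metric G T by fact
  define L where "L = Max (insert 0 (T.len ` S))"
  have L: "T.len s \<le> L" if "s \<in> S" for s unfolding L_def using that gens(1) by (intro Max_ge) auto
  have *: "T.len (word_prod ws) \<le> L * length ws" if "set ws \<subseteq> S" for ws
    using that
  proof (induction ws)
    case (Cons a ws)
    then have "T.len (a \<otimes> word_prod ws) \<le> T.len a + T.len (word_prod ws)"
      using gens by (intro T.len_mult) auto
    then show ?case using Cons L[of a] by simp
  qed simp
  show ?thesis
  proof (intro exI[of _ L] ballI)
    fix g assume "g \<in> carrier G"
    then obtain ws where "length ws = len g" "set ws \<subseteq> S" "word_prod ws = g" using len_witness by blast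
    then show "T.len g \<le> L * len g" using * by metis
  qed
qed

theorem hyp_if_hyperbolic_group:
  assumes "hyperbolic_group G"
  shows "\<exists>\<delta>. hyp \<delta>"
proof -
  obtain T where T: "finite_symmetric_generating_set G T" "gromov_hyperbolic (carrier G) (word_dist G T)"
    using assms unfolding hyperbolic_group_def by blast
  interpret T: word_metric G T by unfold_locales fact
  have "word_dist G T = (\<lambda>x y. real (T.dst x y))" using T.word_dist_eq by blast
  then obtain \<delta> where \<delta>: "T.hyp \<delta>" using T(2) T.gromov_hyperbolic_iff by auto
  obtain L1 where L1: "\<And>g. g \<in> carrier G \<Longrightarrow> T.len g \<le> L1 * len g"
    using len_bilipschitz[OF T.word_metric_axioms] by blast
  obtain L2 where L2: "\<And>g. g \<in> carrier G \<Longrightarrow> len g \<le> L2 * T.len g"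
    using T.len_bilipschitz[OF word_metric_axioms] by blast
  interpret bilipschitz_graph_metrics "carrier G" T.dst dst "max L1 L2"
  proof
    fix x y assume "x \<in> carrier G" "y \<in> carrier G"
    then have g: "inv x \<otimes> y \<in> carrier G" by simp
    show "T.dst x y \<le> max L1 L2 * dst x y" unfolding T.dst_def dst_def
      using L1[OF g] by (meson le_trans max.cobounded1 mult_le_mono1)
    show "dst x y \<le> max L1 L2 * T.dst x y" unfolding T.dst_def dst_def
      using L2[OF g] by (meson le_trans max.cobounded2 mult_le_mono1)
  qed
  show ?thesis using hyp_transfer[OF \<delta>] .
qed

end

section \<open>Sequences of exponential growth\<close>

text \<open>Growth is required from every starting index, not only from 0. Seen from any term, the
  earlier terms decay geometrically, even when b is not monotone.\<close>

definition exp_growth :: "(nat \<Rightarrow> real) \<Rightarrow> bool" where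
  "exp_growth b \<longleftrightarrow> (\<forall>n. 0 < b n) \<and> (\<exists>c>0. \<exists>\<rho>>1. \<forall>m n. c * \<rho> ^ n * b m \<le> b (m + n))"

lemma exp_growthI:
  "\<lbrakk>\<And>n. 0 < b n; 0 < c; 1 < \<rho>; \<And>m n. c * \<rho> ^ n * b m \<le> b (m + n)\<rbrakk> \<Longrightarrow> exp_growth b"
  unfolding exp_growth_def by blast

text \<open>All terms are compared with the one of largest index, from which they decay
  geometrically; C is the sum of that series divided by c. The index set may have gaps, since it
  will be a set of radii or of indices singled out by a comparison.\<close>

lemma exp_growth_sum_le:
  assumes "exp_growth b"
  obtains C where "C > 0"
    "\<And>I y. \<lbrakk>finite I; \<forall>i\<in>I. b i \<le> y; 0 \<le> y\<rbrakk> \<Longrightarrow> (\<Sum>i\<in>I. b i) \<le> C * y"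
proof -
  obtain c \<rho> where c: "c > 0" "\<rho> > 1" "\<And>m n. c * \<rho> ^ n * b m \<le> b (m + n)"
    using assms unfolding exp_growth_def by blast
  define C where "C = 1 / (c * (1 - 1 / \<rho>))"
  have "C > 0" using c by (simp add: C_def)
  moreover have "(\<Sum>i\<in>I. b i) \<le> C * y" if I: "finite I" "\<forall>i\<in>I. b i \<le> y" "0 \<le> y" for I y
  proof (cases "I = {}")
    case True then show ?thesis using \<open>C > 0\<close> I by simp
  next
    case False
    define N where "N = Max I"
    have N: "N \<in> I" "\<And>i. i \<in> I \<Longrightarrow> i \<le> N" using False I(1) by (auto simp: N_def)
    have "b i \<le> y / c * (1 / \<rho>) ^ (N - i)" if "i \<in> I" for i
    proof -
      have "c * \<rho> ^ (N - i) * b i \<le> y" using c(3)[of "N - i" i] N that I(2) by force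
      then show ?thesis using c by (simp add: field_simps power_one_over)
    qed
    then have "(\<Sum>i\<in>I. b i) \<le> (\<Sum>i\<in>I. y / c * (1 / \<rho>) ^ (N - i))" by (rule sum_mono)
    also have "\<dots> = y / c * (\<Sum>k\<in>(\<lambda>i. N - i) ` I. (1 / \<rho>) ^ k)"
    proof -
      have "inj_on (\<lambda>i. N - i) I" using N(2) by (intro inj_onI) (metis diff_diff_cancel)
      then show ?thesis by (simp add: sum.reindex sum_distrib_left o_def)
    qed
    also have "\<dots> \<le> y / c * (1 / (1 - 1 / \<rho>))"
    proof (intro mult_left_mono)
      have s: "(\<lambda>k. (1 / \<rho>) ^ k) sums (1 / (1 - 1 / \<rho>))" using c(2) by (intro geometric_sums) simp
      show "(\<Sum>k\<in>(\<lambda>i. N - i) ` I. (1 / \<rho>) ^ k) \<le> 1 / (1 - 1 / \<rho>)"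
        using sum_le_suminf[OF sums_summable[OF s], of "(\<lambda>i. N - i) ` I"] I c sums_unique[OF s] by simp
    qed (use c I in simp)
    also have "\<dots> = C * y" by (simp add: C_def)
    finally show ?thesis .
  qed
  ultimately show ?thesis by (rule that)
qed

text \<open>The mirror image: reciprocals decay geometrically from the term of smallest
  index.\<close>

lemma exp_growth_sum_inverse_le:
  assumes "exp_growth b"
  obtains C where "C > 0"
    "\<And>I y. \<lbrakk>finite I; \<forall>i\<in>I. y \<le> b i; 0 < y\<rbrakk> \<Longrightarrow> (\<Sum>i\<in>I. 1 / b i) \<le> C / y"
proof -
  obtain c \<rho> where c: "c > 0" "\<rho> > 1" "\<And>m n. c * \<rho> ^ n * b m \<le> b (m + n)" and pos: "\<And>n. 0 < b n"
    using assms unfolding exp_growth_def by blast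
  define C where "C = 1 / (c * (1 - 1 / \<rho>))"
  have "C > 0" using c by (simp add: C_def)
  moreover have "(\<Sum>i\<in>I. 1 / b i) \<le> C / y" if I: "finite I" "\<forall>i\<in>I. y \<le> b i" "0 < y" for I y
  proof (cases "I = {}")
    case True then show ?thesis using \<open>C > 0\<close> I by simp
  next
    case False
    define N where "N = Min I"
    have N: "N \<in> I" "\<And>i. i \<in> I \<Longrightarrow> N \<le> i" using False I(1) by (auto simp: N_def)
    have "1 / b i \<le> 1 / (c * y) * (1 / \<rho>) ^ (i - N)" if "i \<in> I" for i
    proof -
      have "c * \<rho> ^ (i - N) * y \<le> c * \<rho> ^ (i - N) * b N" using I(2) N(1) c by (intro mult_left_mono) auto
      also have "\<dots> \<le> b i" using c(3)[of "i - N" N] N that by simp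
      finally have "1 / b i \<le> 1 / (c * \<rho> ^ (i - N) * y)" using c I(3) pos[of i] by (intro divide_left_mono) auto
      then show ?thesis by (simp add: power_one_over field_simps)
    qed
    then have "(\<Sum>i\<in>I. 1 / b i) \<le> (\<Sum>i\<in>I. 1 / (c * y) * (1 / \<rho>) ^ (i - N))" by (rule sum_mono)
    also have "\<dots> = 1 / (c * y) * (\<Sum>k\<in>(\<lambda>i. i - N) ` I. (1 / \<rho>) ^ k)"
    proof -
      have "inj_on (\<lambda>i. i - N) I" using N(2) by (intro inj_onI) (metis le_add_diff_inverse2)
      then show ?thesis by (simp add: sum.reindex sum_distrib_left o_def)
    qed
    also have "\<dots> \<le> 1 / (c * y) * (1 / (1 - 1 / \<rho>))"
    proof (intro mult_left_mono)
      have s: "(\<lambda>k. (1 / \<rho>) ^ k) sums (1 / (1 - 1 / \<rho>))" using c(2) by (intro geometric_sums) simp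
      show "(\<Sum>k\<in>(\<lambda>i. i - N) ` I. (1 / \<rho>) ^ k) \<le> 1 / (1 - 1 / \<rho>)"
        using sum_le_suminf[OF sums_summable[OF s], of "(\<lambda>i. i - N) ` I"] I c sums_unique[OF s] by simp
    qed (use c I in simp)
    also have "\<dots> = C / y" by (simp add: C_def)
    finally show ?thesis .
  qed
  ultimately show ?thesis by (rule that)
qed

lemma exp_growth_sqrt:
  assumes "exp_growth b"
  shows "exp_growth (\<lambda>n. sqrt (b n))"
proof -
  obtain c \<rho> where c: "c > 0" "\<rho> > 1" "\<And>m n. c * \<rho> ^ n * b m \<le> b (m + n)" and pos: "\<And>n. 0 < b n"
    using assms unfolding exp_growth_def by blast
  have "sqrt c * sqrt \<rho> ^ n * sqrt (b m) \<le> sqrt (b (m + n))" for m n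
    using real_sqrt_le_mono[OF c(3)[of n m]] by (simp add: real_sqrt_mult real_sqrt_power)
  then show ?thesis using c pos by (intro exp_growthI[of _ "sqrt c" "sqrt \<rho>"]) auto
qed

text \<open>The two entries of the minimum multiply to at most \<open>B * x * y * b m\<close>,
  whatever i is, so each minimum is at most the root t of this. On the set where a given entry is
  the smaller one, the sum runs over an exponentially growing sequence bounded by t and is therefore
  O(t).\<close>

lemma exp_growth_sum_min_le:
  assumes "exp_growth b" and B: "B > 0" "\<And>m n. b m * b n \<le> B * b (m + n)"
  obtains C where "C > 0" "\<And>x y m. \<lbrakk>0 \<le> x; 0 \<le> y\<rbrakk> \<Longrightarrow>
           (\<Sum>i\<le>m. min (x * b (m - i)) (y * b i)) \<le> C * sqrt (x * y * b m)"
proof -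
  obtain C where C: "C > 0"
    "\<And>I y. \<lbrakk>finite I; \<forall>i\<in>I. b i \<le> y; 0 \<le> y\<rbrakk> \<Longrightarrow> (\<Sum>i\<in>I. b i) \<le> C * y"
    using exp_growth_sum_le[OF assms(1)] by metis
  have pos: "0 < b n" for n using assms(1) unfolding exp_growth_def by blast
  have scaled: "(\<Sum>i\<in>I. z * b i) \<le> C * t"
    if "finite I" "\<And>i. i \<in> I \<Longrightarrow> z * b i \<le> t" "0 \<le> t" "0 \<le> z" for I z t
  proof (cases "z = 0")
    case False
    then have "(\<Sum>i\<in>I. b i) \<le> C * (t / z)" using that by (intro C(2)) (auto simp: field_simps)
    then show ?thesis using False that by (simp add: field_simps flip: sum_distrib_left)
  qed (use that C in simp)
  have "(\<Sum>i\<le>m. min (x * b (m - i)) (y * b i)) \<le> (2 * C * sqrt B) * sqrt (x * y * b m)"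
    if xy: "0 \<le> x" "0 \<le> y" for x y m
  proof -
    define t where "t = sqrt (x * y * (B * b m))"
    have t: "0 \<le> t" using xy B pos[of m] by (simp add: t_def)
    have min_le: "min (x * b (m - i)) (y * b i) \<le> t" if "i \<le> m" for i
    proof (unfold t_def, rule real_le_rsqrt)
      have "(min (x * b (m - i)) (y * b i))\<^sup>2 \<le> (x * b (m - i)) * (y * b i)"
        unfolding power2_eq_square using xy pos[of i] pos[of "m - i"] by (intro mult_mono) auto
      also have "\<dots> = x * y * (b (m - i) * b i)" by simp
      also have "\<dots> \<le> x * y * (B * b m)"
        using B(2)[of "m - i" i] xy that by (intro mult_left_mono) auto
      finally show "(min (x * b (m - i)) (y * b i))\<^sup>2 \<le> x * y * (B * b m)" .
    qed
    define I where "I = {i. i \<le> m \<and> y * b i \<le> x * b (m - i)}"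
    define J where "J = {i. i \<le> m \<and> \<not> y * b i \<le> x * b (m - i)}"
    have IJ: "{..m} = I \<union> J" "I \<inter> J = {}" "finite I" "finite J" by (auto simp: I_def J_def)
    have "(\<Sum>i\<in>I. min (x * b (m - i)) (y * b i)) = (\<Sum>i\<in>I. y * b i)"
      by (intro sum.cong) (auto simp: I_def)
    also have "\<dots> \<le> C * t"
    proof (rule scaled)
      show "y * b i \<le> t" if "i \<in> I" for i
        using min_le[of i] that by (simp add: I_def min_def split: if_splits)
    qed (use t xy IJ in auto)
    finally have 1: "(\<Sum>i\<in>I. min (x * b (m - i)) (y * b i)) \<le> C * t" .
    have "(\<Sum>i\<in>J. min (x * b (m - i)) (y * b i)) = (\<Sum>i\<in>J. x * b (m - i))"
      by (intro sum.cong) (auto simp: J_def)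
    also have "\<dots> = (\<Sum>k\<in>(\<lambda>i. m - i) ` J. x * b k)"
      by (subst sum.reindex) (auto simp: J_def inj_on_def)
    also have "\<dots> \<le> C * t"
    proof (rule scaled)
      fix k assume "k \<in> (\<lambda>i. m - i) ` J"
      then obtain i where "i \<in> J" "k = m - i" by blast
      then show "x * b k \<le> t" using min_le[of i] by (simp add: J_def min_def split: if_splits)
    qed (use t xy IJ in auto)
    finally have 2: "(\<Sum>i\<in>J. min (x * b (m - i)) (y * b i)) \<le> C * t" .
    have "(\<Sum>i\<le>m. min (x * b (m - i)) (y * b i)) \<le> 2 * C * t"
      unfolding IJ(1) using 1 2 IJ by (subst sum.union_disjoint) auto
    also have "t = sqrt B * sqrt (x * y * b m)"
      unfolding t_def by (simp add: real_sqrt_mult)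
    finally show ?thesis by simp
  qed
  then show ?thesis using C B by (intro that[of "2 * C * sqrt B"]) auto
qed

text \<open>Supermultiplicativity up to K alone still allows constant sequences. A single value
  above \<open>2 * K\<close> turns it into doubling every q steps; the partial sums are then
  comparable with their last terms and inherit both properties.\<close>

lemma exp_growth_partial_sums:
  fixes s :: "nat \<Rightarrow> nat"
  assumes K: "\<And>i j. s i * s j \<le> K * s (i + j)" and pos: "\<And>i. 0 < s i"
    and unbounded: "\<And>M. \<exists>i. M < s i"
  defines "b \<equiv> \<lambda>n. real (\<Sum>i\<le>n. s i)"
  shows "exp_growth b" "\<exists>B>0. \<forall>m n. b m * b n \<le> B * b (m + n)"
proof -
  have "K > 0" using K[of 0 0] pos[of 0] by (metis mult_is_0 le_zero_eq neq0_conv)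
  obtain q where q: "2 * K < s q" using unbounded by blast
  have double: "2 * s m \<le> s (m + q)" for m
  proof -
    have "(2 * K) * s m \<le> s q * s m" using q by (intro mult_le_mono1) simp
    also have "\<dots> \<le> K * s (m + q)" using K[of m q] by (simp add: mult.commute)
    finally have "K * (2 * s m) \<le> K * s (m + q)" by simp
    then show ?thesis using \<open>K > 0\<close> by simp
  qed
  have "q > 0"
  proof (rule ccontr)
    assume "\<not> q > 0" then have "2 * s 0 \<le> s 0" using double[of 0] by simp
    then show False using pos[of 0] by simp
  qed
  define \<rho> where "\<rho> = root q 2"
  have \<rho>: "\<rho> > 1" "\<rho> ^ q = 2" using \<open>q > 0\<close> by (auto simp: \<rho>_def real_root_gt_1_iff)
  have iter: "2 ^ k * s m \<le> s (m + k * q)" for k m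
  proof (induction k)
    case (Suc k)
    have "2 ^ Suc k * s m \<le> 2 * s (m + k * q)" using Suc by simp
    also have "\<dots> \<le> s (m + Suc k * q)" using double[of "m + k * q"] by (simp add: add_ac)
    finally show ?case .
  qed simp
  \<comment> \<open>The factor K pays for the remaining \<open>n mod q\<close> steps, and the 2 for
    \<open>\<rho> ^ (n mod q) \<le> 2\<close>.\<close>
  define c where "c = 1 / (2 * real K)"
  have c: "c > 0" using \<open>K > 0\<close> by (simp add: c_def)
  have growth: "c * \<rho> ^ n * s m \<le> s (m + n)" for m n
  proof -
    have "s (m + n div q * q) \<le> s (m + n div q * q) * s (n mod q)" using pos[of "n mod q"] by simp
    also have "\<dots> \<le> K * s (m + n div q * q + n mod q)" by (rule K)
    also have "m + n div q * q + n mod q = m + n" by simp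
    finally have "2 ^ (n div q) * s m \<le> K * s (m + n)" using iter[of "n div q" m] by linarith
    then have "real (2 ^ (n div q) * s m) \<le> real (K * s (m + n))" by (rule of_nat_mono)
    then have *: "2 ^ (n div q) * real (s m) \<le> real K * s (m + n)" by simp
    have "\<rho> ^ n = (\<rho> ^ q) ^ (n div q) * \<rho> ^ (n mod q)" by (simp flip: power_mult power_add)
    also have "\<dots> \<le> 2 ^ (n div q) * \<rho> ^ q"
      unfolding \<rho>(2) using \<rho>(1) \<open>q > 0\<close> by (simp flip: \<rho>(2))
    finally have "\<rho> ^ n \<le> 2 * 2 ^ (n div q)" using \<rho> by simp
    then have "\<rho> ^ n * s m \<le> 2 * 2 ^ (n div q) * real (s m)" by (intro mult_right_mono) auto
    also have "\<dots> \<le> 2 * (real K * s (m + n))" using * by simp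
    finally show ?thesis using \<open>K > 0\<close> by (simp add: c_def field_simps)
  qed
  have s_growth: "exp_growth (\<lambda>n. real (s n))"
    using pos growth c \<rho>(1) by (intro exp_growthI[of _ c \<rho>]) auto
  obtain C where C: "C > 0"
    "\<And>I y. \<lbrakk>finite I; \<forall>i\<in>I. real (s i) \<le> y; 0 \<le> y\<rbrakk> \<Longrightarrow> (\<Sum>i\<in>I. real (s i)) \<le> C * y"
    using exp_growth_sum_le[OF s_growth] by metis
  \<comment> \<open>Positivity of \<open>s (n - i)\<close> gives \<open>s i \<le> K * s n\<close>
    for \<open>i \<le> n\<close>, so s is almost monotone and the sum bound applies with
    \<open>y = K * s n\<close>.\<close>
  define D where "D = C * real K"
  have "D > 0" using C \<open>K > 0\<close> by (simp add: D_def)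
  moreover have "b n \<le> D * s n" for n
  proof -
    have "real (s i) \<le> real K * s n" if "i \<le> n" for i
    proof -
      have "s i * 1 \<le> s i * s (n - i)" using pos[of "n - i"] by (intro mult_le_mono2) simp
      also have "\<dots> \<le> K * s n" using K[of i "n - i"] that by simp
      finally have "real (s i) \<le> real (K * s n)" by (intro of_nat_mono) simp
      then show ?thesis by simp
    qed
    then have "b n \<le> C * (real K * s n)"
      unfolding b_def of_nat_sum by (intro C(2)) auto
    then show ?thesis by (simp add: D_def mult.assoc)
  qed
  ultimately have D: "D > 0" "\<And>n. b n \<le> D * s n" by blast+
  have s_le: "s n \<le> b n" for n
    unfolding b_def of_nat_le_iff by (rule member_le_sum) auto
  show "\<exists>B>0. \<forall>m n. b m * b n \<le> B * b (m + n)"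
  proof (intro exI[of _ "D * D * K"] conjI allI)
    fix m n
    have "b m * b n \<le> (D * s m) * (D * s n)" using D by (intro mult_mono) (auto simp: b_def sum_nonneg)
    also have "\<dots> = D * D * real (s m * s n)" by simp
    also have "\<dots> \<le> D * D * real (K * s (m + n))" using K D by (intro mult_left_mono of_nat_mono) auto
    also have "\<dots> = D * D * K * real (s (m + n))" by simp
    also have "\<dots> \<le> D * D * K * b (m + n)" using s_le D by (intro mult_left_mono) auto
    finally show "b m * b n \<le> D * D * K * b (m + n)" .
  qed (use D \<open>K > 0\<close> in simp)
  have "c / D * \<rho> ^ n * b m \<le> b (m + n)" for m n
  proof -
    have "c / D * \<rho> ^ n * b m \<le> c / D * \<rho> ^ n * (D * s m)"
      using D c \<rho> by (intro mult_left_mono) auto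
    also have "\<dots> = c * \<rho> ^ n * s m" using D by simp
    also have "\<dots> \<le> b (m + n)" using growth[of n m] s_le[of "m + n"] by simp
    finally show ?thesis .
  qed
  moreover have "0 < b n" for n using s_le[of n] pos[of n] by (metis less_le_trans of_nat_0_less_iff)
  ultimately show "exp_growth b" using c D \<rho> by (intro exp_growthI[of b "c / D" \<rho>]) auto
qed

section \<open>Growth of balls and spheres in a hyperbolic group\<close>

lemma card_le_fibres:
  assumes "finite U" "f ` A \<subseteq> U" "\<And>u. u \<in> U \<Longrightarrow> card {x \<in> A. f x = u} \<le> k"
  shows "card A \<le> card U * k"
proof -
  have "A = (\<Union>u\<in>U. {x \<in> A. f x = u})" using assms(2) by auto
  then have "card A \<le> (\<Sum>u\<in>U. card {x \<in> A. f x = u})" using card_UN_le[OF assms(1)] by metis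
  also have "\<dots> \<le> card U * k" using sum_bounded_above[of U, OF assms(3)] by simp
  finally show ?thesis .
qed

context word_metric begin

lemma card_le_cb_if_close:
  assumes "finite A" "A \<subseteq> carrier G" "\<And>x y. \<lbrakk>x \<in> A; y \<in> A\<rbrakk> \<Longrightarrow> dst x y \<le> n"
  shows "card A \<le> card (cb n)"
proof (cases "A = {}")
  case False
  then obtain z where z: "z \<in> A" by blast
  have "inj_on (\<lambda>x. inv z \<otimes> x) A"
    using assms(2) z by (intro inj_onI) (simp add: subset_iff)
  moreover have "(\<lambda>x. inv z \<otimes> x) ` A \<subseteq> cb n"
    using assms(2,3) z unfolding dst_def cb_def by auto
  ultimately show ?thesis using card_inj_on_le finite_cb by blast
qed simp

text \<open>
  If the first alternative fails, \<open>\<beta> x = d(x, h) - d(1, h)\<close> is a quasimorphism on the R-ball. With p at depth R on a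
  geodesic from 1 to h, all inverses of \<open>p\<^sup>-\<^sup>1 x\<close> with \<open>\<beta> x = j\<close> lie near the point at depth R + j
  on that geodesic, so the fibres of \<open>\<beta>\<close> are bounded.
\<close>

lemma directions_or_linear_growth:
  assumes hyp: "hyp \<delta>"
  shows "(\<exists>R C. \<forall>g\<in>carrier G. \<forall>h\<in>carrier G. \<exists>a\<in>cb R. gp \<one> g (a \<otimes> h) \<le> real C)
       \<or> (\<forall>n. card (cb n) \<le> (2 * n + 1) * card (cb (14 * \<delta>)))"
proof (rule disjCI)
  assume "\<not> (\<forall>n. card (cb n) \<le> (2 * n + 1) * card (cb (14 * \<delta>)))"
  then obtain R where R: "\<not> card (cb R) \<le> (2 * R + 1) * card (cb (14 * \<delta>))" by blast
  \<comment> \<open>Both the radius and the constant in the negated alternative are set to n. The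
    margin over R is there because the quasimorphism estimate is applied to
    \<open>inv p \<otimes> x\<close>, of length at most \<open>2 * R + 2 * \<delta>\<close>, and
    asks for one further \<delta>.\<close>
  define n where "n = 2 * R + 3 * \<delta>"
  show "\<exists>R C. \<forall>g\<in>carrier G. \<forall>h\<in>carrier G. \<exists>a\<in>cb R. gp \<one> g (a \<otimes> h) \<le> real C"
  proof (rule ccontr)
    assume "\<not> ?thesis"
    then obtain g h where gh: "g \<in> carrier G" "h \<in> carrier G"
      and far: "\<And>a. a \<in> cb n \<Longrightarrow> real n < gp \<one> g (a \<otimes> h)" by (meson not_le)
    \<comment> \<open>The case \<open>a = \<one>\<close> shows that g and h point in the same
      direction, so g can be replaced by h at the cost of one \<delta>.\<close>
    have *: "real n - \<delta> \<le> gp \<one> h (a \<otimes> h)" if "a \<in> cb n" for a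
    proof -
      have "\<one> \<in> cb n" "a \<in> carrier G" using that by (auto simp: cb_def)
      then show ?thesis
        using hypD[OF hyp one_closed gh(2,1), of "a \<otimes> h"] far[of \<one>] far[OF that] gh gp_sym[of h g \<one>] by simp
    qed
    have "real n < len h" using far[of \<one>] gp_le[of \<one> h g] gp_sym[OF gh, of \<one>] gh by (simp add: cb_def)
    then have "R \<le> len h" by (simp add: n_def)
    define \<beta> where "\<beta> x = int (dst x h) - int (len h)" for x
    \<comment> \<open>With \<open>h' = inv a \<otimes> h\<close> the defect equals
      \<open>(dst y h' - len h') - (dst y h - len h)\<close>. Seen from the identity, h and
      \<open>h'\<close> agree up to depth \<open>n - \<delta>\<close>, so a point y of no greater
      length can hardly tell them apart.\<close>
    have quasi: "\<bar>\<beta> (a \<otimes> y) - \<beta> a - \<beta> y\<bar> \<le> 2 * \<delta>"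
      if a: "a \<in> cb n" and y: "y \<in> carrier G" "len y + \<delta> \<le> n" for a y
    proof -
      define h' where "h' = inv a \<otimes> h"
      have aG: "a \<in> carrier G" "h' \<in> carrier G" "inv a \<in> cb n" using a gh by (auto simp: cb_def h'_def)
      have h: "a \<otimes> h' = h" unfolding h'_def using aG gh by (simp flip: m_assoc)
      have ay: "dst (a \<otimes> y) h = dst y h'" using dst_left_mult[of a y h'] aG y h by simp
      have a1: "dst a h = len h'" using dst_left_mult[of a \<one> h'] aG h by simp
      have "real n - \<delta> \<le> gp \<one> h h'" using * aG unfolding h'_def by blast
      then have "2 * n + dst h h' \<le> len h + len h' + 2 * \<delta>"
        unfolding gp_def using gh aG by simp
      moreover note hyp_four_point[OF hyp gh(2) y(1) one_closed aG(2)]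
        hyp_four_point[OF hyp gh(2) one_closed y(1) aG(2)] sym[OF aG(2) gh(2)]
      moreover have "len h' \<le> len y + dst y h'" "len h \<le> len y + dst y h"
        using tri[of \<one> y h'] tri[of \<one> y h] y gh aG by auto
      ultimately show ?thesis unfolding \<beta>_def ay a1 using y aG gh by simp
    qed
    obtain p where p: "p \<in> carrier G" "len p = R" "dst p h = len h - R"
      using interp[of \<one> h R] gh \<open>R \<le> len h\<close> by auto
    have \<beta>p: "\<beta> p = - int R" using p \<open>R \<le> len h\<close> by (simp add: \<beta>_def)
    have \<beta>_bound: "\<bar>\<beta> x\<bar> \<le> len x" if "x \<in> carrier G" for x
      using tri[of x \<one> h] tri[of \<one> x h] that gh unfolding \<beta>_def by simp
    \<comment> \<open>Inversion reverses the sign of \<beta>. So \<beta> of \<open>v x\<close> is at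
      most about \<open>- (R + \<beta> x)\<close> while the length of \<open>v x\<close> is at most
      about \<open>R + \<beta> x\<close>; only points near the geodesic to h approach h at full
      speed.\<close>
    define v where "v x = inv (inv p \<otimes> x)" for x
    have v: "v x \<in> carrier G" "int (len (v x)) \<le> R + \<beta> x + 2 * \<delta>" "\<beta> (v x) \<le> 4 * int \<delta> - int R - \<beta> x"
      if x: "x \<in> cb R" for x
    proof -
      have xG: "x \<in> carrier G" "len x \<le> R" using x by (auto simp: cb_def)
      show "v x \<in> carrier G" using xG p by (simp add: v_def)
      have "int (dst x h) = len h + \<beta> x" by (simp add: \<beta>_def)
      moreover have "dst x p + dst \<one> h \<le> max (dst x \<one> + dst p h) (dst \<one> p + dst x h) + 2 * \<delta>"
        using hyp_four_point[OF hyp] xG p gh by blast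
      ultimately have xp: "int (dst x p) \<le> R + \<beta> x + 2 * \<delta>"
        using p xG gh \<open>R \<le> len h\<close> \<beta>_bound[OF xG(1)] by simp
      have y: "inv p \<otimes> x \<in> carrier G" "len (inv p \<otimes> x) = dst x p"
        using xG p sym[of x p] unfolding dst_def by auto
      then show "int (len (v x)) \<le> R + \<beta> x + 2 * \<delta>" unfolding v_def using xp by simp
      have "int (dst x p) + \<delta> \<le> int n" using xp \<beta>_bound[OF xG(1)] xG(2) unfolding n_def by simp
      then have small: "len (inv p \<otimes> x) + \<delta> \<le> n" using y(2) by simp
      have "\<bar>\<beta> (p \<otimes> (inv p \<otimes> x)) - \<beta> p - \<beta> (inv p \<otimes> x)\<bar> \<le> 2 * \<delta>"
        using p y small by (intro quasi) (auto simp: cb_def n_def)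
      moreover have "p \<otimes> (inv p \<otimes> x) = x" using p xG by (simp flip: m_assoc)
      moreover have "\<bar>\<beta> (v x \<otimes> (inv p \<otimes> x)) - \<beta> (v x) - \<beta> (inv p \<otimes> x)\<bar> \<le> 2 * \<delta>"
        using y small unfolding v_def by (intro quasi) (auto simp: cb_def)
      moreover have "v x \<otimes> (inv p \<otimes> x) = \<one>" using y unfolding v_def by simp
      moreover have "\<beta> \<one> = 0" using gh by (simp add: \<beta>_def)
      ultimately show "\<beta> (v x) \<le> 4 * int \<delta> - int R - \<beta> x" using \<beta>p by simp
    qed
    have fibre: "card {x \<in> cb R. \<beta> x = j} \<le> card (cb (14 * \<delta>))" for j
    proof -
      have inj: "inj_on v (cb R)"
      proof (rule inj_onI)
        fix x y assume xy: "x \<in> cb R" "y \<in> cb R" "v x = v y"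
        then have "inv (v x) = inv (v y)" by simp
        moreover have "x \<in> carrier G" "y \<in> carrier G" using xy cb_carrier by blast+
        ultimately have "inv p \<otimes> x = inv p \<otimes> y" using p by (simp add: v_def)
        then show "x = y" using xy p by (simp add: cb_def)
      qed
      \<comment> \<open>The 14 is \<open>2 * 2 + 2 * 5\<close>: each length exceeds
        \<open>R + j\<close> by at most \<open>2 * \<delta>\<close>, and the product falls short of
        \<open>R + j\<close> by at most \<open>5 * \<delta>\<close>, four from the bound on \<beta>
        and one from hyperbolicity.\<close>
      have close: "dst (v x) (v y) \<le> 14 * \<delta>" if x: "x \<in> cb R" "\<beta> x = j" and y: "y \<in> cb R" "\<beta> y = j" for x y
      proof -
        have "int R + j - 4 * int \<delta> \<le> gp \<one> (v z) h" if z: "z \<in> cb R" "\<beta> z = j" for z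
        proof -
          have "2 * gp \<one> (v z) h = real_of_int (len (v z) - \<beta> (v z))"
            using v(1)[OF z(1)] gh unfolding gp_def \<beta>_def by simp
          moreover have "2 * (int R + j - 4 * int \<delta>) \<le> len (v z) - \<beta> (v z)"
            using v(3)[OF z(1)] \<beta>_bound[OF v(1)[OF z(1)]] z(2) by (simp add: abs_le_iff)
          ultimately have "real_of_int (2 * (int R + j - 4 * int \<delta>)) \<le> 2 * gp \<one> (v z) h"
            by (metis of_int_le_iff)
          then show ?thesis by simp
        qed
        then have "int R + j - 4 * int \<delta> \<le> gp \<one> (v x) h" "int R + j - 4 * int \<delta> \<le> gp \<one> h (v y)"
          using x y v(1)[OF y(1)] gh gp_sym[of h "v y" \<one>] by auto
        then have "int R + j - 5 * int \<delta> \<le> gp \<one> (v x) (v y)"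
          using hypD[OF hyp one_closed v(1)[OF x(1)] gh(2) v(1)[OF y(1)]] by simp
        moreover have "real (dst (v x) (v y)) = len (v x) + len (v y) - 2 * gp \<one> (v x) (v y)"
          using v(1) x y unfolding gp_def by (simp add: field_simps)
        moreover have "real (len (v x)) \<le> R + j + 2 * \<delta>" "real (len (v y)) \<le> R + j + 2 * \<delta>"
          using v(2)[OF x(1)] v(2)[OF y(1)] x(2) y(2) by linarith+
        ultimately have "real (dst (v x) (v y)) \<le> 14 * \<delta>" by simp
        then show ?thesis by linarith
      qed
      have "card {x \<in> cb R. \<beta> x = j} = card (v ` {x \<in> cb R. \<beta> x = j})"
        by (intro card_image[symmetric] inj_on_subset[OF inj]) auto
      also have "\<dots> \<le> card (cb (14 * \<delta>))"
        using close v(1) by (intro card_le_cb_if_close) auto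
      finally show ?thesis .
    qed
    have "\<beta> ` cb R \<subseteq> {- int R..int R}"
      using \<beta>_bound unfolding cb_def by force
    then have "card (cb R) \<le> card {- int R..int R} * card (cb (14 * \<delta>))"
      using fibre by (intro card_le_fibres) auto
    moreover have "card {- int R..int R} = 2 * R + 1" by simp
    ultimately show False using R by metis
  qed
qed

definition sph :: "nat \<Rightarrow> 'a set" where "sph n = {g \<in> carrier G. len g = n}"

lemma finite_sph [simp]: "finite (sph n)"
  by (rule finite_subset[OF _ finite_cb[of n]]) (auto simp: sph_def cb_def)

text \<open>Cutting at depth m. This allows pairs from two spheres to be mapped into an annulus of
  bounded width instead of an exact sphere.\<close>

lemma card_annulus_le: "card {g \<in> carrier G. m \<le> len g \<and> len g \<le> m + n} \<le> card (sph m) * card (cb n)"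
proof -
  let ?A = "{g \<in> carrier G. m \<le> len g \<and> len g \<le> m + n}"
  have "\<forall>g\<in>?A. \<exists>p. p \<in> carrier G \<and> len p = m \<and> len (inv p \<otimes> g) = len g - m"
    using len_split by blast
  from bchoice[OF this] obtain p
    where p: "\<And>g. g \<in> ?A \<Longrightarrow> p g \<in> carrier G \<and> len (p g) = m \<and> len (inv (p g) \<otimes> g) = len g - m"
    by blast
  have "inj_on (\<lambda>g. (p g, inv (p g) \<otimes> g)) ?A"
  proof (rule inj_onI)
    fix g h assume gh: "g \<in> ?A" "h \<in> ?A" and eq: "(p g, inv (p g) \<otimes> g) = (p h, inv (p h) \<otimes> h)"
    then have "inv (p h) \<otimes> g = inv (p h) \<otimes> h" by (metis Pair_inject)
    then show "g = h" using gh p[OF gh(2)] by simp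
  qed
  moreover have "(\<lambda>g. (p g, inv (p g) \<otimes> g)) ` ?A \<subseteq> sph m \<times> cb n"
  proof
    fix z assume "z \<in> (\<lambda>g. (p g, inv (p g) \<otimes> g)) ` ?A"
    then obtain g where "g \<in> ?A" "z = (p g, inv (p g) \<otimes> g)" by blast
    then show "z \<in> sph m \<times> cb n" using p[of g] by (auto simp: sph_def cb_def)
  qed
  ultimately have "card ?A \<le> card (sph m \<times> cb n)" by (intro card_inj_on_le) auto
  then show ?thesis by (simp add: card_cartesian_product)
qed

lemma card_sph_pos:
  assumes "infinite (carrier G)"
  shows "0 < card (sph n)"
proof -
  have "\<not> carrier G \<subseteq> cb n" using assms finite_cb finite_subset by blast
  then obtain g where "g \<in> carrier G" "n \<le> len g" unfolding cb_def by (force simp: not_le)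
  then obtain p where "p \<in> sph n" using len_split[of g n] unfolding sph_def by blast
  then show ?thesis by (auto simp: card_gt_0_iff)
qed

lemma card_cb_eq_sum: "card (cb n) = (\<Sum>i\<le>n. card (sph i))"
proof -
  have "cb n = (\<Union>i\<in>{..n}. sph i)" by (auto simp: cb_def sph_def)
  moreover have "sph i \<inter> sph j = {}" if "i \<noteq> j" for i j using that by (auto simp: sph_def)
  ultimately show ?thesis by (simp add: card_UN_disjoint)
qed

text \<open>
  The map \<open>(g, h) \<mapsto> g a h\<close> with the a provided by the hypothesis has bounded fibres: g is determined up to
  bounded error as the point at depth |g| on a geodesic from 1 to the image.
\<close>

lemma sph_supermultiplicative:
  assumes hyp: "hyp \<delta>" and inf: "infinite (carrier G)"
    and dir: "\<And>g h. \<lbrakk>g \<in> carrier G; h \<in> carrier G\<rbrakk> \<Longrightarrow> \<exists>a\<in>cb R. gp \<one> g (a \<otimes> h) \<le> real C"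
  shows "\<exists>K. \<forall>i j. card (sph i) * card (sph j) \<le> K * card (sph (i + j))"
proof -
  \<comment> \<open>The possible error in the length of a concatenation: at most R from the
    connector and at most \<open>2 * C\<close> from cancellation at g.\<close>
  define P where "P = R + 2 * C"
  define k where "k = card (cb (2 * C + 2 * \<delta>)) * card (cb R)"
  define K where "K = card (cb (2 * P)) * k"
  \<comment> \<open>The hypothesis is applied to \<open>inv g\<close>, since left translation by g
    turns \<open>gp \<one> (inv g) y\<close> into \<open>gp g \<one> (g \<otimes> y)\<close>: a path
    through g hardly backtracks there.\<close>
  obtain a where a: "\<And>g h. \<lbrakk>g \<in> carrier G; h \<in> carrier G\<rbrakk> \<Longrightarrow> a g h \<in> cb R \<and> gp \<one> (inv g) (a g h \<otimes> h) \<le> real C"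
  proof -
    have "\<forall>g h. \<exists>a. g \<in> carrier G \<longrightarrow> h \<in> carrier G \<longrightarrow> a \<in> cb R \<and> gp \<one> (inv g) (a \<otimes> h) \<le> real C"
      using dir inv_closed by blast
    then show ?thesis using that by metis
  qed
  define \<Phi> where "\<Phi> = (\<lambda>(g, h). g \<otimes> (a g h \<otimes> h))"
  have \<Phi>: "\<Phi> (g, h) \<in> carrier G" "gp g \<one> (\<Phi> (g, h)) \<le> C"
      "len g + len h \<le> len (\<Phi> (g, h)) + P" "len (\<Phi> (g, h)) \<le> len g + len h + P"
    if g: "g \<in> carrier G" and h: "h \<in> carrier G" for g h
  proof -
    have aG: "a g h \<in> carrier G" "len (a g h) \<le> R" using a[OF g h] by (auto simp: cb_def)
    define y where "y = a g h \<otimes> h"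
    have y: "y \<in> carrier G" "len y \<le> R + len h" using aG h len_mult[of "a g h" h] by (auto simp: y_def)
    have \<Phi>: "\<Phi> (g, h) = g \<otimes> y" by (simp add: \<Phi>_def y_def)
    then show "\<Phi> (g, h) \<in> carrier G" using g y by simp
    have "gp \<one> (inv g) y \<le> C" using a[OF g h] by (simp add: y_def)
    moreover have "dst (inv g) y = len (g \<otimes> y)" using g by (simp add: dst_def)
    ultimately have *: "real (len g) + len y \<le> len (g \<otimes> y) + 2 * C" using g y by (simp add: gp_def)
    have "dst (g \<otimes> y) g = len y" using dst_left_mult[of g y \<one>] g y by simp
    then show "gp g \<one> (\<Phi> (g, h)) \<le> C" using * g y \<Phi> by (simp add: gp_def)
    have "h = inv (a g h) \<otimes> y" using aG h unfolding y_def by (simp flip: m_assoc)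
    then have "len h \<le> R + len y" using len_mult[of "inv (a g h)" y] aG y by simp
    then show "len g + len h \<le> len (\<Phi> (g, h)) + P" using * \<Phi> unfolding P_def by simp
    show "len (\<Phi> (g, h)) \<le> len g + len h + P" using len_mult[OF g y(1)] y \<Phi> by (simp add: P_def)
  qed
  have fibre: "card {x \<in> sph i \<times> sph j. \<Phi> x = u} \<le> k" for i j u
  proof (cases "{x \<in> sph i \<times> sph j. \<Phi> x = u} = {}")
    case False
    then obtain g0 h0 where Z: "g0 \<in> sph i" "h0 \<in> sph j" "\<Phi> (g0, h0) = u" by auto
    have Z': "g0 \<in> carrier G" "h0 \<in> carrier G" using Z by (auto simp: sph_def)
    have u: "u \<in> carrier G" using \<Phi>(1)[OF Z'] Z(3) by simp
    \<comment> \<open>Once u is fixed, these data give g and the connector, hence h by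
      cancellation.\<close>
    define f where "f = (\<lambda>(g, h). (inv g0 \<otimes> g, a g h))"
    let ?A = "{x \<in> sph i \<times> sph j. \<Phi> x = u}"
    have "inj_on f ?A"
    proof (rule inj_onI, clarify)
      fix g h g' h'
      assume *: "g \<in> sph i" "h \<in> sph j" "u = \<Phi> (g, h)" "g' \<in> sph i" "h' \<in> sph j"
        "\<Phi> (g', h') = \<Phi> (g, h)" "f (g, h) = f (g', h')"
      then have G: "g \<in> carrier G" "h \<in> carrier G" "g' \<in> carrier G" "h' \<in> carrier G" by (auto simp: sph_def)
      have 1: "inv g0 \<otimes> g = inv g0 \<otimes> g'" and 2: "a g h = a g' h'" using *(7) by (simp_all add: f_def)
      have "g = g'" using 1 G Z' by simp
      have aG: "a g h \<in> carrier G" using a[OF G(1,2)] cb_carrier by blast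
      have "a g h' = a g h" using 2 unfolding \<open>g = g'\<close> by (rule HOL.sym)
      then have "g \<otimes> (a g h \<otimes> h') = g \<otimes> (a g h \<otimes> h)"
        using *(6) unfolding \<Phi>_def prod.case \<open>g = g'\<close>[symmetric] by metis
      then have "h' = h" using G aG by simp
      then show "g = g' \<and> h = h'" using \<open>g = g'\<close> by simp
    qed
    moreover have "f ` ?A \<subseteq> cb (2 * C + 2 * \<delta>) \<times> cb R"
    proof
      fix z assume "z \<in> f ` ?A"
      then obtain g h where gh: "g \<in> sph i" "h \<in> sph j" "u = \<Phi> (g, h)" and z: "z = f (g, h)" by auto
      then have G: "g \<in> carrier G" "h \<in> carrier G" by (auto simp: sph_def)
      have "i - real C \<le> gp \<one> x u" if "gp x \<one> u \<le> C" "x \<in> sph i" for x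
        using that u sym[of x u] unfolding gp_def sph_def by (simp add: field_simps)
      then have "i - real C \<le> gp \<one> g u" "i - real C \<le> gp \<one> u g0"
        using \<Phi>(2)[OF G] \<Phi>(2)[OF Z'] Z gh gp_sym[OF u Z'(1)] by auto
      then have "i - real C - \<delta> \<le> gp \<one> g g0" using hypD[OF hyp one_closed G(1) u Z'(1)] by simp
      then have "dst g0 g \<le> 2 * C + 2 * \<delta>"
        using G Z' Z(1) gh(1) sym[of g g0] unfolding gp_def sph_def by simp
      then have "inv g0 \<otimes> g \<in> cb (2 * C + 2 * \<delta>)" using G Z' by (simp add: cb_def dst_def)
      then show "z \<in> cb (2 * C + 2 * \<delta>) \<times> cb R" using a[OF G] z by (simp add: f_def)
    qed
    ultimately have "card ?A \<le> card (cb (2 * C + 2 * \<delta>) \<times> cb R)" by (intro card_inj_on_le) auto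
    then show ?thesis by (simp add: card_cartesian_product k_def)
  next
    case True
    show ?thesis unfolding True by simp
  qed
  \<comment> \<open>Lengthening the second factor by P makes the image annulus start exactly at
    \<open>i + j\<close>.\<close>
  have main: "card (sph i) * card (sph (j + P)) \<le> K * card (sph (i + j))" for i j
  proof -
    let ?U = "{g \<in> carrier G. i + j \<le> len g \<and> len g \<le> i + j + 2 * P}"
    have "card (sph i \<times> sph (j + P)) \<le> card ?U * k"
    proof (rule card_le_fibres)
      show "finite ?U" by (rule finite_subset[OF _ finite_cb[of "i + j + 2 * P"]]) (auto simp: cb_def)
      show "\<Phi> ` (sph i \<times> sph (j + P)) \<subseteq> ?U"
      proof
        fix z assume "z \<in> \<Phi> ` (sph i \<times> sph (j + P))"
        then obtain g h where "g \<in> sph i" "h \<in> sph (j + P)" "z = \<Phi> (g, h)" by auto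
        then show "z \<in> ?U" using \<Phi>(1,3,4)[of g h] by (simp add: sph_def)
      qed
    qed (rule fibre)
    also have "\<dots> \<le> card (sph (i + j)) * card (cb (2 * P)) * k"
      using card_annulus_le[of "i + j" "2 * P"] by (intro mult_le_mono1) simp
    finally show ?thesis by (simp add: card_cartesian_product K_def ac_simps)
  qed
  \<comment> \<open>The shift by P is undone by a second use of \<open>main\<close>, with the
    nonempty sphere of radius \<open>P + P\<close> as second factor.\<close>
  have "card (sph i) * card (sph j) \<le> K * K * card (sph (i + j))" for i j
  proof -
    have "card (sph j) * 1 \<le> card (sph j) * card (sph (P + P))"
      using card_sph_pos[OF inf, of "P + P"] by (intro mult_le_mono2) simp
    also have "\<dots> \<le> K * card (sph (j + P))" using main[of j P] .
    finally have "card (sph i) * card (sph j) \<le> card (sph i) * (K * card (sph (j + P)))" by simp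
    also have "\<dots> = K * (card (sph i) * card (sph (j + P)))" by simp
    also have "\<dots> \<le> K * (K * card (sph (i + j)))" using main[of i j] by (rule mult_le_mono2)
    finally show ?thesis by simp
  qed
  then show ?thesis by blast
qed

end

section \<open>Weak type estimates\<close>

context word_metric begin

definition bl :: "'a \<Rightarrow> nat \<Rightarrow> 'a set" where "bl x n = {u \<in> carrier G. dst x u \<le> n}"

lemma bl_eq_image: "x \<in> carrier G \<Longrightarrow> bl x n = (\<lambda>g. x \<otimes> g) ` cb n"
proof -
  assume x: "x \<in> carrier G"
  have "u \<in> (\<lambda>g. x \<otimes> g) ` cb n" if "u \<in> bl x n" for u
  proof (rule image_eqI)
    show "u = x \<otimes> (inv x \<otimes> u)" using that x by (simp add: bl_def flip: m_assoc)
    show "inv x \<otimes> u \<in> cb n" using that x by (simp add: bl_def cb_def dst_def)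
  qed
  moreover have "x \<otimes> g \<in> bl x n" if "g \<in> cb n" for g
    using that x dst_left_mult[of x \<one> g] by (simp add: bl_def cb_def)
  ultimately show ?thesis by blast
qed

lemma finite_bl [simp]: "x \<in> carrier G \<Longrightarrow> finite (bl x n)"
  by (simp add: bl_eq_image)

lemma card_bl [simp]: "x \<in> carrier G \<Longrightarrow> card (bl x n) = card (cb n)"
proof -
  assume x: "x \<in> carrier G"
  then have "inj_on (\<lambda>g. x \<otimes> g) (cb n)" by (intro inj_onI) (simp add: cb_def)
  then show ?thesis using x by (simp add: bl_eq_image card_image)
qed

lemma one_in_cb: "\<one> \<in> cb n"
  by (simp add: cb_def)

lemma card_cb_pos: "0 < card (cb n)"
  using one_in_cb finite_cb by (metis card_gt_0_iff empty_iff)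

lemma cb_mono: "m \<le> n \<Longrightarrow> cb m \<subseteq> cb n"
  by (auto simp: cb_def)

lemma card_cb_add_le: "card (cb (m + n)) \<le> card (cb m) * card (cb n)"
proof -
  have "cb (m + n) \<subseteq> (\<lambda>(p, q). p \<otimes> q) ` (cb m \<times> cb n)"
  proof
    fix g assume g: "g \<in> cb (m + n)"
    then have gG: "g \<in> carrier G" "len g \<le> m + n" by (auto simp: cb_def)
    obtain p where p: "p \<in> carrier G" "len p = min m (len g)" "len (inv p \<otimes> g) = len g - min m (len g)"
      using len_split[of g "min m (len g)"] gG by auto
    have "g = p \<otimes> (inv p \<otimes> g)" using p gG by (simp flip: m_assoc)
    moreover have "p \<in> cb m" "inv p \<otimes> g \<in> cb n" using p gG by (auto simp: cb_def)
    ultimately show "g \<in> (\<lambda>(p, q). p \<otimes> q) ` (cb m \<times> cb n)" by force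
  qed
  then have "card (cb (m + n)) \<le> card ((\<lambda>(p, q). p \<otimes> q) ` (cb m \<times> cb n))"
    by (intro card_mono) auto
  also have "\<dots> \<le> card (cb m \<times> cb n)" by (intro card_image_le) auto
  finally show ?thesis by (simp add: card_cartesian_product)
qed

text \<open>The maximal inequality linearised at level 1: k selects for each x one radius with a
  large average. Other levels follow by scaling f, and finite X keeps all counting finite.\<close>

definition weak_type :: "real \<Rightarrow> bool" where
  "weak_type C \<longleftrightarrow> (\<forall>f X k. finite X \<longrightarrow> X \<subseteq> carrier G \<longrightarrow> (\<forall>u\<in>carrier G. 0 \<le> f u) \<longrightarrow>
      f summable_on carrier G \<longrightarrow>
      (\<forall>x\<in>X. real (card (cb (k x))) < (\<Sum>u\<in>bl x (k x). f u)) \<longrightarrow>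
      real (card X) \<le> C * (\<Sum>\<^sub>\<infinity>u\<in>carrier G. f u))"

text \<open>Greedy choice by largest radius. Only the centres have to be covered, not the whole
  balls, so the factor 2 suffices.\<close>

lemma vitali:
  assumes "finite X" "X \<subseteq> carrier G"
  shows "\<exists>Y\<subseteq>X. (\<forall>x\<in>Y. \<forall>y\<in>Y. x \<noteq> y \<longrightarrow> bl x (k x) \<inter> bl y (k y) = {}) \<and>
           (\<forall>x\<in>X. \<exists>y\<in>Y. dst y x \<le> 2 * k y)"
  using assms
proof (induction X rule: finite_psubset_induct)
  case (psubset X)
  show ?case
  proof (cases "X = {}")
    case False
    then have "Max (k ` X) \<in> k ` X" using psubset.hyps by (intro Max_in) auto
    then obtain z where "z \<in> X" "k z = Max (k ` X)" by auto
    then have z: "z \<in> X" "\<And>x. x \<in> X \<Longrightarrow> k x \<le> k z" using psubset.hyps by auto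
    define X' where "X' = {x \<in> X. bl x (k x) \<inter> bl z (k z) = {}}"
    have "z \<in> bl z (k z)" using z psubset.prems by (auto simp: bl_def)
    then have "X' \<subset> X" using z by (auto simp: X'_def)
    moreover from this have "X' \<subseteq> carrier G" using psubset.prems by blast
    ultimately obtain Y where Y: "Y \<subseteq> X'" "\<And>x y. \<lbrakk>x \<in> Y; y \<in> Y; x \<noteq> y\<rbrakk> \<Longrightarrow> bl x (k x) \<inter> bl y (k y) = {}"
        "\<And>x. x \<in> X' \<Longrightarrow> \<exists>y\<in>Y. dst y x \<le> 2 * k y"
      using psubset.IH[of X'] by meson
    have "\<exists>y\<in>insert z Y. dst y x \<le> 2 * k y" if x: "x \<in> X" for x
    proof (cases "x \<in> X'")
      case False
      then obtain w where "w \<in> bl x (k x)" "w \<in> bl z (k z)" using x by (auto simp: X'_def)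
      then have w: "w \<in> carrier G" "dst x w \<le> k x" "dst z w \<le> k z" by (auto simp: bl_def)
      have G: "x \<in> carrier G" "z \<in> carrier G" using x z psubset.prems by auto
      have "dst z x \<le> 2 * k z" using tri[OF G(2) w(1) G(1)] sym[OF w(1) G(1)] w z(2)[OF x] by simp
      then show ?thesis by blast
    next
      case True
      from Y(3)[OF this] show ?thesis by blast
    qed
    moreover have "\<forall>x\<in>insert z Y. \<forall>y\<in>insert z Y. x \<noteq> y \<longrightarrow> bl x (k x) \<inter> bl y (k y) = {}"
      using Y(1,2) by (auto simp: X'_def)
    moreover have "insert z Y \<subseteq> X" using z Y(1) by (auto simp: X'_def)
    ultimately show ?thesis by blast
  qed simp
qed

lemma weak_type_doubling:
  assumes D: "\<And>n. card (cb (2 * n)) \<le> D * card (cb n)"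
  shows "weak_type (real D)"
  unfolding weak_type_def
proof (intro allI impI)
  fix f :: "'a \<Rightarrow> real" and X k
  assume X: "finite X" "X \<subseteq> carrier G" and f: "\<forall>u\<in>carrier G. 0 \<le> f u" "f summable_on carrier G"
    and k: "\<forall>x\<in>X. real (card (cb (k x))) < (\<Sum>u\<in>bl x (k x). f u)"
  obtain Y where Y: "Y \<subseteq> X" "\<And>x y. \<lbrakk>x \<in> Y; y \<in> Y; x \<noteq> y\<rbrakk> \<Longrightarrow> bl x (k x) \<inter> bl y (k y) = {}"
      "\<And>x. x \<in> X \<Longrightarrow> \<exists>y\<in>Y. dst y x \<le> 2 * k y"
    using vitali[OF X, of k] by meson
  have YG: "Y \<subseteq> carrier G" "finite Y" using Y(1) X finite_subset by auto
  have "X \<subseteq> (\<Union>y\<in>Y. bl y (2 * k y))" using Y(3) X(2) by (force simp: bl_def)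
  then have "card X \<le> card (\<Union>y\<in>Y. bl y (2 * k y))"
    using YG by (intro card_mono finite_UN_I) auto
  also have "\<dots> \<le> (\<Sum>y\<in>Y. card (bl y (2 * k y)))" using YG(2) by (rule card_UN_le)
  also have "\<dots> \<le> (\<Sum>y\<in>Y. D * card (cb (k y)))" using YG D by (intro sum_mono) auto
  finally have "real (card X) \<le> real (\<Sum>y\<in>Y. D * card (cb (k y)))" by (rule of_nat_mono)
  also have "\<dots> = real D * (\<Sum>y\<in>Y. real (card (cb (k y))))" by (simp add: sum_distrib_left)
  also have "\<dots> \<le> real D * (\<Sum>y\<in>Y. \<Sum>u\<in>bl y (k y). f u)"
    using k Y(1) by (intro mult_left_mono sum_mono) (auto intro: less_imp_le)
  also have "(\<Sum>y\<in>Y. \<Sum>u\<in>bl y (k y). f u) = (\<Sum>u\<in>(\<Union>y\<in>Y. bl y (k y)). f u)"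
    using YG Y(2) by (intro sum.UNION_disjoint[symmetric]) auto
  also have "real D * \<dots> \<le> real D * (\<Sum>\<^sub>\<infinity>u\<in>carrier G. f u)"
  proof (intro mult_left_mono finite_sum_le_infsum f(2))
    show "finite (\<Union>y\<in>Y. bl y (k y))" using YG by (intro finite_UN_I) auto
    show "(\<Union>y\<in>Y. bl y (k y)) \<subseteq> carrier G" by (auto simp: bl_def)
  qed (use f(1) in auto)
  finally show "real (card X) \<le> real D * (\<Sum>\<^sub>\<infinity>u\<in>carrier G. f u)" .
qed

text \<open>All such u lie behind one point p, at depth j on a geodesic from x to the identity:
  after p at most \<open>m - j\<close> remains, up to \<open>2 * \<delta>\<close>. When j exceeds
  the distance from x to the identity there is no p, but then no u either.\<close>

lemma card_cone_le:
  assumes hyp: "hyp \<delta>" and x: "x \<in> carrier G" and j: "j \<le> m"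
  shows "card {u \<in> carrier G. dst x u \<le> m \<and> real j \<le> gp x u \<one>} \<le> card (cb (m - j + 2 * \<delta>))"
proof (cases "{u \<in> carrier G. dst x u \<le> m \<and> real j \<le> gp x u \<one>} = {}")
  case False
  then obtain u0 where u0: "u0 \<in> carrier G" "real j \<le> gp x u0 \<one>" by auto
  have "gp x u0 \<one> \<le> dst x \<one>" using gp_le[of x \<one> u0] gp_sym[of u0 \<one> x] u0 x by simp
  then have "j \<le> dst x \<one>" using u0(2) by linarith
  then obtain p where p: "p \<in> carrier G" "dst x p = j" "dst p \<one> = dst x \<one> - j"
    using interp[OF x one_closed] by blast
  have p1: "gp x \<one> p = j" using p x sym[of p x] \<open>j \<le> dst x \<one>\<close> sym[of p \<one>] unfolding gp_def by simp
  have "{u \<in> carrier G. dst x u \<le> m \<and> real j \<le> gp x u \<one>} \<subseteq> bl p (m - j + 2 * \<delta>)"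
  proof
    fix u assume "u \<in> {u \<in> carrier G. dst x u \<le> m \<and> real j \<le> gp x u \<one>}"
    then have u: "u \<in> carrier G" "dst x u \<le> m" "real j \<le> gp x u \<one>" by auto
    have "real j - \<delta> \<le> gp x u p" using hypD[OF hyp x u(1) one_closed p(1)] u(3) p1 by simp
    then have "real (dst p u) \<le> real (dst x u) - real j + 2 * real \<delta>"
      unfolding gp_def using p sym[OF u(1) x] sym[OF p(1) x] sym[OF u(1) p(1)] by (simp add: field_simps)
    then have "real (dst p u) \<le> real (m - j + 2 * \<delta>)" using u(2) j by simp
    then show "u \<in> bl p (m - j + 2 * \<delta>)" using u by (simp add: bl_def)
  qed
  then have "card {u \<in> carrier G. dst x u \<le> m \<and> real j \<le> gp x u \<one>} \<le> card (bl p (m - j + 2 * \<delta>))"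
    using p(1) by (intro card_mono) auto
  then show ?thesis using p(1) by simp
next
  case True
  show ?thesis unfolding True by simp
qed

text \<open>The pairs are sorted by the depth i at which the route from x to u leaves the route from
  x to the identity. The corresponding depths from x and from u add up to m, so the cone bound can
  be used from either end.\<close>

lemma card_pairs_at_distance_le:
  assumes hyp: "hyp \<delta>" and X: "finite X" "X \<subseteq> carrier G" and E: "finite E" "E \<subseteq> carrier G"
  shows "card {z \<in> X \<times> E. dst (fst z) (snd z) = m}
     \<le> (\<Sum>i\<le>m. min (card X * card (cb (m - i + 2 * \<delta>))) (card E * card (cb (i + 1 + 2 * \<delta>))))"
proof -
  define T where "T i = {z \<in> X \<times> E. dst (fst z) (snd z) = m \<and> nat \<lfloor>gp (fst z) (snd z) \<one>\<rfloor> = i}" for i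
  have "nat \<lfloor>gp x u \<one>\<rfloor> \<le> m" if "x \<in> X" "u \<in> E" "dst x u = m" for x u
  proof -
    have G: "x \<in> carrier G" "u \<in> carrier G" using that X E by auto
    have "gp x u \<one> \<le> m" using gp_le[OF G one_closed] sym[OF G] that(3) by simp
    then show ?thesis by linarith
  qed
  then have "{z \<in> X \<times> E. dst (fst z) (snd z) = m} \<subseteq> (\<Union>i\<in>{..m}. T i)" by (auto simp: T_def)
  moreover have finT: "finite (T i)" for i using X E by (simp add: T_def)
  ultimately have "card {z \<in> X \<times> E. dst (fst z) (snd z) = m} \<le> card (\<Union>i\<in>{..m}. T i)"
    by (intro card_mono) auto
  also have "\<dots> \<le> (\<Sum>i\<le>m. card (T i))" by (rule card_UN_le) simp
  also have "\<dots> \<le> (\<Sum>i\<le>m. min (card X * card (cb (m - i + 2 * \<delta>))) (card E * card (cb (i + 1 + 2 * \<delta>))))"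
  proof (rule sum_mono)
    fix i assume "i \<in> {..m}"
    then have i: "i \<le> m" by simp
    have z: "fst z \<in> carrier G" "snd z \<in> carrier G" "dst (fst z) (snd z) = m"
      "real i \<le> gp (fst z) (snd z) \<one>" "real (m - Suc i) \<le> gp (snd z) (fst z) \<one>" if "z \<in> T i" for z
    proof -
      show G: "fst z \<in> carrier G" "snd z \<in> carrier G" "dst (fst z) (snd z) = m"
        using that X E by (auto simp: T_def)
      have nonneg: "0 \<le> gp (fst z) (snd z) \<one>" "0 \<le> gp (snd z) (fst z) \<one>" using gp_nonneg G by auto
      have fl: "nat \<lfloor>gp (fst z) (snd z) \<one>\<rfloor> = i" using that by (simp add: T_def)
      then show "real i \<le> gp (fst z) (snd z) \<one>" using nonneg by linarith
      have "gp (fst z) (snd z) \<one> < i + 1" using fl nonneg by linarith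
      moreover have "gp (fst z) (snd z) \<one> + gp (snd z) (fst z) \<one> = m"
        using G sym[of "fst z" "snd z"] unfolding gp_def by (simp add: field_simps)
      ultimately have "real m - (i + 1) \<le> gp (snd z) (fst z) \<one>" by linarith
      then show "real (m - Suc i) \<le> gp (snd z) (fst z) \<one>" using nonneg by (cases "Suc i \<le> m") auto
    qed
    have "card (T i) \<le> card X * card (cb (m - i + 2 * \<delta>))"
    proof (rule card_le_fibres[OF X(1)])
      show "fst ` T i \<subseteq> X" by (auto simp: T_def)
      fix x assume x: "x \<in> X"
      have "card {z \<in> T i. fst z = x} \<le> card {u \<in> carrier G. dst x u \<le> m \<and> real i \<le> gp x u \<one>}"
      proof (rule card_inj_on_le[where f = snd])
        show "finite {u \<in> carrier G. dst x u \<le> m \<and> real i \<le> gp x u \<one>}"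
          using x X by (intro finite_subset[OF _ finite_bl[of x m]]) (auto simp: bl_def)
      qed (use z in \<open>auto simp: inj_on_def prod_eq_iff\<close>)
      also have "\<dots> \<le> card (cb (m - i + 2 * \<delta>))" using card_cone_le[OF hyp _ i] x X by blast
      finally show "card {z \<in> T i. fst z = x} \<le> card (cb (m - i + 2 * \<delta>))" .
    qed
    moreover have "card (T i) \<le> card E * card (cb (i + 1 + 2 * \<delta>))"
    proof (rule card_le_fibres[OF E(1)])
      show "snd ` T i \<subseteq> E" by (auto simp: T_def)
      fix u assume u: "u \<in> E"
      \<comment> \<open>The product at u is more than \<open>m - (i + 1)\<close>, whence the extra 1
        in the radius. The subtraction truncates at \<open>i = m\<close>; the cone condition is void
        there, and the radius m is still at most \<open>i + 1\<close>.\<close>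
      have "card {z \<in> T i. snd z = u} \<le> card {x \<in> carrier G. dst u x \<le> m \<and> real (m - Suc i) \<le> gp u x \<one>}"
      proof (rule card_inj_on_le[where f = fst])
        show "finite {x \<in> carrier G. dst u x \<le> m \<and> real (m - Suc i) \<le> gp u x \<one>}"
          using u E by (intro finite_subset[OF _ finite_bl[of u m]]) (auto simp: bl_def)
        show "fst ` {z \<in> T i. snd z = u} \<subseteq> {x \<in> carrier G. dst u x \<le> m \<and> real (m - Suc i) \<le> gp u x \<one>}"
          using z sym by force
      qed (auto simp: inj_on_def prod_eq_iff)
      also have "\<dots> \<le> card (cb (m - (m - Suc i) + 2 * \<delta>))" using card_cone_le[OF hyp, of u "m - Suc i" m] u E by auto
      also have "\<dots> \<le> card (cb (i + 1 + 2 * \<delta>))" by (intro card_mono cb_mono) auto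
      finally show "card {z \<in> T i. snd z = u} \<le> card (cb (i + 1 + 2 * \<delta>))" .
    qed
    ultimately show "card (T i) \<le> min (card X * card (cb (m - i + 2 * \<delta>))) (card E * card (cb (i + 1 + 2 * \<delta>)))"
      by simp
  qed
  finally show ?thesis .
qed

end

section \<open>The weak type inequality under pure exponential growth\<close>

lemma power_interval_exists:
  fixes x c :: real
  assumes "1 \<le> x" "1 < c"
  shows "\<exists>n. c ^ n \<le> x \<and> x < c ^ Suc n"
proof -
  define n where "n = (LEAST n. x < c ^ n)"
  have "\<exists>n. x < c ^ n" using real_arch_pow[OF assms(2)] by blast
  then have "x < c ^ n" unfolding n_def by (rule LeastI_ex)
  moreover from this assms(1) have "n \<noteq> 0" by (cases "n = 0") auto
  then obtain m where m: "n = Suc m" using not0_implies_Suc by blast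
  moreover have "\<not> x < c ^ m" using not_less_Least[of m "\<lambda>n. x < c ^ n"] m n_def by simp
  ultimately show ?thesis by (intro exI[of _ m]) auto
qed

context word_metric begin

abbreviation vol :: "nat \<Rightarrow> real" where "vol n \<equiv> real (card (cb n))"

text \<open>Shifting radii by \<open>1 + 2 * \<delta>\<close> costs only the factor Q, after which
  the minima sum to a multiple of \<open>sqrt (vol m)\<close> for each exact distance m. These roots
  again grow exponentially, so the largest distance k dominates.\<close>

lemma card_close_pairs_le:
  assumes hyp: "hyp \<delta>" and eg: "exp_growth vol"
    and B: "B > 0" "\<And>m n. vol m * vol n \<le> B * vol (m + n)"
  obtains C where "C > 0"
    "\<And>X E k. \<lbrakk>finite X; X \<subseteq> carrier G; finite E; E \<subseteq> carrier G\<rbrakk> \<Longrightarrow>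
       real (card {z \<in> X \<times> E. dst (fst z) (snd z) \<le> k}) \<le> C * sqrt (real (card X) * real (card E) * vol k)"
proof -
  obtain C1 where C1: "C1 > 0" "\<And>x y m. \<lbrakk>0 \<le> x; 0 \<le> y\<rbrakk> \<Longrightarrow>
      (\<Sum>i\<le>m. min (x * vol (m - i)) (y * vol i)) \<le> C1 * sqrt (x * y * vol m)"
    by (rule exp_growth_sum_min_le[where b = vol and B = B, OF eg B]) (rule that)
  obtain C2 where C2: "C2 > 0"
    "\<And>I y. \<lbrakk>finite I; \<forall>i\<in>I. sqrt (vol i) \<le> y; 0 \<le> y\<rbrakk> \<Longrightarrow> (\<Sum>i\<in>I. sqrt (vol i)) \<le> C2 * y"
    by (rule exp_growth_sum_le[OF exp_growth_sqrt[OF eg]]) (rule that)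
  define Q where "Q = vol (1 + 2 * \<delta>)"
  have Q: "Q > 0" using card_cb_pos by (simp add: Q_def)
  have vol_Q: "vol n' \<le> Q * vol n" if "n' \<le> n + (1 + 2 * \<delta>)" for n n'
  proof -
    have "card (cb n') \<le> card (cb (n + (1 + 2 * \<delta>)))" using that by (intro card_mono cb_mono) auto
    also have "\<dots> \<le> card (cb n) * card (cb (1 + 2 * \<delta>))" by (rule card_cb_add_le)
    finally have "vol n' \<le> real (card (cb n) * card (cb (1 + 2 * \<delta>)))" by (rule of_nat_mono)
    then show ?thesis by (simp add: Q_def mult.commute)
  qed
  have main: "real (card {z \<in> X \<times> E. dst (fst z) (snd z) \<le> k})
       \<le> (Q * C1 * C2) * sqrt (real (card X) * real (card E) * vol k)"
    if X: "finite X" "X \<subseteq> carrier G" and E: "finite E" "E \<subseteq> carrier G" for X E k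
  proof -
    define x y where "x = real (card X)" and "y = real (card E)"
    have xy: "0 \<le> x" "0 \<le> y" by (auto simp: x_def y_def)
    have dist: "real (card {z \<in> X \<times> E. dst (fst z) (snd z) = m}) \<le> Q * C1 * sqrt (x * y) * sqrt (vol m)" for m
    proof -
      have "real (card {z \<in> X \<times> E. dst (fst z) (snd z) = m})
          \<le> (\<Sum>i\<le>m. min (x * vol (m - i + 2 * \<delta>)) (y * vol (i + 1 + 2 * \<delta>)))"
        using of_nat_mono[OF card_pairs_at_distance_le[OF hyp X E, of m], where 'a = real]
        by (simp add: x_def y_def of_nat_min)
      also have "\<dots> \<le> (\<Sum>i\<le>m. min (x * (Q * vol (m - i))) (y * (Q * vol i)))"
        using xy by (intro sum_mono min.mono mult_left_mono vol_Q) auto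
      also have "\<dots> = Q * (\<Sum>i\<le>m. min (x * vol (m - i)) (y * vol i))"
        unfolding sum_distrib_left using Q by (intro sum.cong) (auto simp: min_mult_distrib_left mult_ac)
      also have "\<dots> \<le> Q * (C1 * sqrt (x * y * vol m))"
        using C1(2)[OF xy] Q by (intro mult_left_mono) auto
      finally show ?thesis by (simp add: real_sqrt_mult mult_ac)
    qed
    have eq: "{z \<in> X \<times> E. dst (fst z) (snd z) \<le> k} = (\<Union>m\<in>{..k}. {z \<in> X \<times> E. dst (fst z) (snd z) = m})" by auto
    have "card {z \<in> X \<times> E. dst (fst z) (snd z) \<le> k} \<le> (\<Sum>m\<le>k. card {z \<in> X \<times> E. dst (fst z) (snd z) = m})"
      unfolding eq by (rule card_UN_le) simp
    then have "real (card {z \<in> X \<times> E. dst (fst z) (snd z) \<le> k})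
        \<le> (\<Sum>m\<le>k. real (card {z \<in> X \<times> E. dst (fst z) (snd z) = m}))"
      unfolding of_nat_sum[symmetric] by (rule of_nat_mono)
    also have "\<dots> \<le> (\<Sum>m\<le>k. Q * C1 * sqrt (x * y) * sqrt (vol m))" by (intro sum_mono dist)
    also have "\<dots> = Q * C1 * sqrt (x * y) * (\<Sum>m\<le>k. sqrt (vol m))" by (simp add: sum_distrib_left)
    also have "\<dots> \<le> Q * C1 * sqrt (x * y) * (C2 * sqrt (vol k))"
    proof (intro mult_left_mono C2(2) ballI)
      show "sqrt (vol i) \<le> sqrt (vol k)" if "i \<in> {..k}" for i
        using that card_mono[OF finite_cb cb_mono[of i k]] by simp
    qed (use Q C1 xy in auto)
    finally show ?thesis by (simp add: x_def y_def real_sqrt_mult mult_ac)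
  qed
  show ?thesis using main Q C1(1) C2(1) by (intro that[of "Q * C1 * C2"]) auto
qed

theorem weak_type_exp_growth:
  assumes hyp: "hyp \<delta>" and eg: "exp_growth vol"
    and B: "B > 0" "\<And>m n. vol m * vol n \<le> B * vol (m + n)"
  shows "\<exists>C. weak_type C"
proof -
  obtain C0 where C0: "C0 > 0"
    "\<And>X E k. \<lbrakk>finite X; X \<subseteq> carrier G; finite E; E \<subseteq> carrier G\<rbrakk> \<Longrightarrow>
       real (card {z \<in> X \<times> E. dst (fst z) (snd z) \<le> k}) \<le> C0 * sqrt (real (card X) * real (card E) * vol k)"
    by (rule card_close_pairs_le[OF hyp eg B]) (rule that)
  obtain C1 where C1: "C1 > 0"
    "\<And>I y. \<lbrakk>finite I; \<forall>i\<in>I. vol i \<le> y; 0 \<le> y\<rbrakk> \<Longrightarrow> (\<Sum>i\<in>I. vol i) \<le> C1 * y"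
    by (rule exp_growth_sum_le[OF eg]) (rule that)
  have eg2: "exp_growth (\<lambda>n. 2 ^ n)" by (rule exp_growthI[of _ 1 2]) (auto simp: power_add)
  obtain C2 where C2: "C2 > 0"
    "\<And>I y. \<lbrakk>finite I; \<forall>i\<in>I. 2 ^ i \<le> y; 0 \<le> y\<rbrakk> \<Longrightarrow> (\<Sum>i\<in>I. (2::real) ^ i) \<le> C2 * y"
    by (rule exp_growth_sum_le[OF eg2]) (rule that)
  obtain C3 where C3: "C3 > 0"
    "\<And>I y. \<lbrakk>finite I; \<forall>i\<in>I. y \<le> sqrt (vol i); 0 < y\<rbrakk> \<Longrightarrow> (\<Sum>i\<in>I. 1 / sqrt (vol i)) \<le> C3 / y"
    by (rule exp_growth_sum_inverse_le[OF exp_growth_sqrt[OF eg]]) (rule that)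
  have vol_pos: "0 < vol n" for n using card_cb_pos by simp
  \<comment> \<open>Here \<open>16 * C0 ^ 2\<close> is the square of the factor in
    \<open>s \<le> 4 * C0 * T\<close>, and \<open>C2 * sqrt 2\<close> comes from the first
    Cauchy--Schwarz sum.\<close>
  define C4 where "C4 = 16 * C0\<^sup>2 * C2 * sqrt 2"
  have C4: "C4 > 0" using C0 C2 by (simp add: C4_def)
  have "weak_type (C1 + 2 * sqrt 2 * C4 * C3)"
    unfolding weak_type_def
  proof (intro allI impI)
    fix f :: "'a \<Rightarrow> real" and X k
    assume X: "finite X" "X \<subseteq> carrier G" and f: "\<forall>u\<in>carrier G. 0 \<le> f u" "f summable_on carrier G"
      and k: "\<forall>x\<in>X. vol (k x) < (\<Sum>u\<in>bl x (k x). f u)"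
    define U where "U = (\<Union>x\<in>X. bl x (k x))"
    have U: "finite U" "U \<subseteq> carrier G" using X by (auto simp: U_def bl_def[of _ "k _"] intro!: finite_bl[unfolded bl_def])
    have f0: "0 \<le> f u" if "u \<in> U" for u using that U f by blast
    \<comment> \<open>A value of f above the volume of the ball is too high for the level sums
      below. Centres that see such a value are charged to its position: u pays for one ball per
      radius j with \<open>vol j < f u\<close>, and these volumes add up to at most
      \<open>C1 * f u\<close>.\<close>
    define X1 where "X1 = {x \<in> X. \<exists>u\<in>bl x (k x). vol (k x) < f u}"
    define X2 where "X2 = X - X1"
    have X12: "finite X1" "finite X2" "X1 \<subseteq> X" "X2 \<subseteq> X" using X by (auto simp: X1_def X2_def)
    have card1: "real (card X1) \<le> C1 * (\<Sum>u\<in>U. f u)"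
    proof -
      define J where "J u = {j \<in> k ` X. vol j < f u}" for u
      have finJ: "finite (J u)" for u using X by (simp add: J_def)
      have "X1 \<subseteq> (\<Union>u\<in>U. \<Union>j\<in>J u. bl u j)"
      proof
        fix x assume "x \<in> X1"
        then obtain u where x: "x \<in> X" and u: "u \<in> bl x (k x)" "vol (k x) < f u" by (auto simp: X1_def)
        have "u \<in> U" using x u by (auto simp: U_def)
        moreover have "k x \<in> J u" using x u by (simp add: J_def)
        moreover have "x \<in> bl u (k x)" using u x X sym[of x u] by (auto simp: bl_def)
        ultimately show "x \<in> (\<Union>u\<in>U. \<Union>j\<in>J u. bl u j)" by blast
      qed
      then have "card X1 \<le> card (\<Union>u\<in>U. \<Union>j\<in>J u. bl u j)"
        using U finJ by (intro card_mono finite_UN_I finite_bl) auto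
      also have "\<dots> \<le> (\<Sum>u\<in>U. card (\<Union>j\<in>J u. bl u j))" using U(1) by (rule card_UN_le)
      also have "\<dots> \<le> (\<Sum>u\<in>U. \<Sum>j\<in>J u. card (bl u j))" using finJ by (intro sum_mono card_UN_le)
      also have "\<dots> = (\<Sum>u\<in>U. \<Sum>j\<in>J u. card (cb j))" using U by (intro sum.cong) auto
      finally have "real (card X1) \<le> real (\<Sum>u\<in>U. \<Sum>j\<in>J u. card (cb j))" by (rule of_nat_mono)
      also have "\<dots> = (\<Sum>u\<in>U. \<Sum>j\<in>J u. vol j)" by simp
      also have "\<dots> \<le> (\<Sum>u\<in>U. C1 * f u)"
        using finJ f0 by (intro sum_mono C1(2)) (auto simp: J_def)
      finally show ?thesis by (simp add: sum_distrib_left)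
    qed
    \<comment> \<open>Levels start at \<open>f u = 1 / 2\<close>, because smaller values contribute
      at most half of the required sum. Base 4 makes the square roots below powers of 2.\<close>
    have "\<forall>u. \<exists>n. 1 \<le> 2 * f u \<longrightarrow> 4 ^ n \<le> 2 * f u \<and> 2 * f u < 4 ^ Suc n"
      using power_interval_exists[of _ 4] by force
    then obtain lev where lev: "\<And>u. 1 \<le> 2 * f u \<Longrightarrow> 4 ^ lev u \<le> 2 * f u \<and> 2 * f u < 4 ^ Suc (lev u)"
      by metis
    define E where "E n = {u \<in> U. 1 \<le> 2 * f u \<and> lev u = n}" for n
    define N where "N = lev ` U"
    define Y where "Y j = {x \<in> X2. k x = j}" for j
    have finE: "finite (E n)" "E n \<subseteq> carrier G" for n using U by (auto simp: E_def)
    have finN: "finite N" using U by (simp add: N_def)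
    have finY: "finite (Y j)" "Y j \<subseteq> carrier G" for j using X X12 by (auto simp: Y_def)
    have cardY: "real (card (Y j)) \<le> C4 * (1 / sqrt (vol j)) * (\<Sum>n\<in>{n \<in> N. 4 ^ n \<le> 2 * vol j}. 8 ^ n * real (card (E n)))" for j
    proof -
      \<comment> \<open>For a centre outside \<open>X1\<close> with radius j every value in the ball
        is at most \<open>vol j\<close>, so only these levels occur.\<close>
      define Nj where "Nj = {n \<in> N. 4 ^ n \<le> 2 * vol j}"
      have finNj: "finite Nj" using finN by (simp add: Nj_def)
      have pointwise: "vol j / 2 \<le> (\<Sum>n\<in>Nj. 2 * 4 ^ n * real (card {u \<in> E n. dst x u \<le> j}))" if x: "x \<in> Y j" for x
      proof -
        have xX: "x \<in> X" "x \<notin> X1" "k x = j" "x \<in> carrier G" using x X by (auto simp: Y_def X2_def)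
        let ?L = "{u \<in> bl x j. \<not> 1 \<le> 2 * f u}" and ?H = "{u \<in> bl x j. 1 \<le> 2 * f u}"
        have bl: "bl x j = ?L \<union> ?H" by blast
        have "(\<Sum>u\<in>bl x j. f u) = (\<Sum>u\<in>?L. f u) + (\<Sum>u\<in>?H. f u)"
          using xX(4) by (subst bl, intro sum.union_disjoint) auto
        moreover have "(\<Sum>u\<in>?L. f u) \<le> vol j / 2"
        proof -
          have "(\<Sum>u\<in>?L. f u) \<le> (\<Sum>u\<in>?L. 1 / 2)" by (intro sum_mono) auto
          also have "\<dots> \<le> (\<Sum>u\<in>bl x j. 1 / 2)" using xX(4) by (intro sum_mono2) auto
          finally show ?thesis using xX(4) by simp
        qed
        moreover have "(\<Sum>u\<in>?H. f u) \<le> (\<Sum>n\<in>Nj. 2 * 4 ^ n * real (card {u \<in> E n. dst x u \<le> j}))"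
        proof -
          have H: "u \<in> U" "lev u \<in> Nj" "f u \<le> 2 * 4 ^ lev u" if "u \<in> ?H" for u
          proof -
            show "u \<in> U" using that xX by (auto simp: U_def)
            moreover have "f u \<le> vol j" using that xX by (auto simp: X1_def)
            ultimately show "lev u \<in> Nj" using lev[of u] that by (auto simp: Nj_def N_def)
            show "f u \<le> 2 * 4 ^ lev u" using lev[of u] that by simp
          qed
          have "(\<Sum>u\<in>?H. f u) = (\<Sum>n\<in>Nj. \<Sum>u\<in>{u \<in> ?H. lev u = n}. f u)"
            using H(2) finNj xX(4) by (intro sum.group[symmetric]) auto
          also have "\<dots> \<le> (\<Sum>n\<in>Nj. \<Sum>u\<in>{u \<in> ?H. lev u = n}. 2 * 4 ^ n)"
            using H(3) by (intro sum_mono) auto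
          also have "\<dots> \<le> (\<Sum>n\<in>Nj. 2 * 4 ^ n * real (card {u \<in> E n. dst x u \<le> j}))"
          proof (rule sum_mono)
            fix n
            have "card {u \<in> ?H. lev u = n} \<le> card {u \<in> E n. dst x u \<le> j}"
              using H(1) U(1) by (intro card_mono) (auto simp: E_def bl_def)
            then show "(\<Sum>u\<in>{u \<in> ?H. lev u = n}. 2 * 4 ^ n) \<le> 2 * 4 ^ n * real (card {u \<in> E n. dst x u \<le> j})"
              by simp
          qed
          finally show ?thesis .
        qed
        moreover have "vol j < (\<Sum>u\<in>bl x j. f u)" using k xX by auto
        ultimately show ?thesis by linarith
      qed
      define A where "A = real (card (Y j))"
      define T where "T = (\<Sum>n\<in>Nj. 4 ^ n * sqrt (real (card (E n))))"
      have T0: "0 \<le> T" unfolding T_def by (intro sum_nonneg) auto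
      have pairs: "(\<Sum>x\<in>Y j. real (card {u \<in> E n. dst x u \<le> j})) \<le> C0 * sqrt (A * real (card (E n)) * vol j)" for n
      proof -
        have "{z \<in> Y j \<times> E n. dst (fst z) (snd z) \<le> j} = Sigma (Y j) (\<lambda>x. {u \<in> E n. dst x u \<le> j})" by auto
        then have "card {z \<in> Y j \<times> E n. dst (fst z) (snd z) \<le> j} = (\<Sum>x\<in>Y j. card {u \<in> E n. dst x u \<le> j})"
          using finY finE by simp
        then show ?thesis using C0(2)[OF finY[of j] finE[of n], of j] by (simp add: A_def)
      qed
      have "A * (vol j / 2) = (\<Sum>x\<in>Y j. vol j / 2)" by (simp add: A_def)
      also have "\<dots> \<le> (\<Sum>x\<in>Y j. \<Sum>n\<in>Nj. 2 * 4 ^ n * real (card {u \<in> E n. dst x u \<le> j}))"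
        by (intro sum_mono pointwise)
      also have "\<dots> = (\<Sum>n\<in>Nj. \<Sum>x\<in>Y j. 2 * 4 ^ n * real (card {u \<in> E n. dst x u \<le> j}))" by (rule sum.swap)
      also have "\<dots> = (\<Sum>n\<in>Nj. 2 * 4 ^ n * (\<Sum>x\<in>Y j. real (card {u \<in> E n. dst x u \<le> j})))"
        by (simp add: sum_distrib_left)
      also have "\<dots> \<le> (\<Sum>n\<in>Nj. 2 * 4 ^ n * (C0 * sqrt (A * real (card (E n)) * vol j)))"
        by (intro sum_mono mult_left_mono pairs) auto
      also have "\<dots> = 2 * C0 * sqrt (A * vol j) * T"
        unfolding T_def sum_distrib_left by (intro sum.cong) (auto simp: real_sqrt_mult)
      finally have le: "A * vol j \<le> 4 * C0 * T * sqrt (A * vol j)" by (simp add: mult_ac)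
      \<comment> \<open>The unknown A stands on both sides, on the right only under a root;
        cancelling one factor s bounds it.\<close>
      define s where "s = sqrt (A * vol j)"
      have s: "0 \<le> s" "s * s = A * vol j" using vol_pos[of j] by (auto simp: s_def A_def)
      have "s \<le> 4 * C0 * T"
      proof (cases "s = 0")
        case True then show ?thesis using C0 T0 by simp
      next
        case False
        then show ?thesis using le s unfolding s_def[symmetric] s(2)[symmetric] by (simp add: mult_le_cancel_right)
      qed
      then have "s * s \<le> (4 * C0 * T) * (4 * C0 * T)" using s C0 T0 by (intro mult_mono) auto
      then have 1: "A * vol j \<le> 16 * C0\<^sup>2 * T\<^sup>2" using s(2) by (simp add: power2_eq_square mult_ac)
      \<comment> \<open>The base 2 of the weight lies strictly between 1 and 4. Being above 1, it
        makes the first Cauchy--Schwarz sum comparable with its largest possible term,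
        \<open>sqrt (2 * vol j)\<close>. Being below 4, it leaves the factor
        \<open>1 / sqrt (vol j)\<close> in the bound for A that makes the later sum over radii
        converge.\<close>
      have T_eq: "T = (\<Sum>n\<in>Nj. sqrt (2 ^ n) * sqrt (8 ^ n * real (card (E n))))"
      proof -
        have "sqrt (2 ^ n) * sqrt (8 ^ n * c) = 4 ^ n * sqrt c" for n and c :: real
        proof -
          have "sqrt (2 ^ n) * sqrt (8 ^ n * c) = sqrt (2 ^ n * 8 ^ n) * sqrt c" by (simp add: real_sqrt_mult)
          also have "(2::real) ^ n * 8 ^ n = (4 ^ n)\<^sup>2" by (simp flip: power_mult_distrib power_mult add: power2_eq_square)
          finally show ?thesis by simp
        qed
        then show ?thesis by (simp add: T_def)
      qed
      have "T\<^sup>2 \<le> (\<Sum>n\<in>Nj. (sqrt (2 ^ n))\<^sup>2) * (\<Sum>n\<in>Nj. (sqrt (8 ^ n * real (card (E n))))\<^sup>2)"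
        unfolding T_eq by (rule Cauchy_Schwarz_ineq_sum)
      also have "\<dots> = (\<Sum>n\<in>Nj. 2 ^ n) * (\<Sum>n\<in>Nj. 8 ^ n * real (card (E n)))" by simp
      also have "\<dots> \<le> (C2 * sqrt (2 * vol j)) * (\<Sum>n\<in>Nj. 8 ^ n * real (card (E n)))"
      proof (intro mult_right_mono C2(2) finNj sum_nonneg ballI)
        fix n assume "n \<in> Nj"
        then have "(4::real) ^ n \<le> 2 * vol j" by (simp add: Nj_def)
        moreover have "(4::real) ^ n = (2 ^ n)\<^sup>2" by (simp flip: power_mult_distrib add: power2_eq_square)
        ultimately show "2 ^ n \<le> sqrt (2 * vol j)" by (metis real_le_rsqrt)
      qed auto
      finally have "A * vol j \<le> 16 * C0\<^sup>2 * ((C2 * sqrt (2 * vol j)) * (\<Sum>n\<in>Nj. 8 ^ n * real (card (E n))))"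
        using 1 by (smt (verit) mult_left_mono zero_le_power2)
      also have "\<dots> = vol j * (C4 * (1 / sqrt (vol j)) * (\<Sum>n\<in>Nj. 8 ^ n * real (card (E n))))"
      proof -
        have *: "vol j * (1 / sqrt (vol j)) = sqrt (vol j)"
          using vol_pos[of j] by (simp add: real_div_sqrt)
        have "vol j * (C4 * (1 / sqrt (vol j)) * R) = C4 * (vol j * (1 / sqrt (vol j))) * R" for R
          by (simp only: mult_ac)
        then show ?thesis unfolding * by (simp add: C4_def real_sqrt_mult)
      qed
      finally have "vol j * A \<le> vol j * (C4 * (1 / sqrt (vol j)) * (\<Sum>n\<in>Nj. 8 ^ n * real (card (E n))))"
        by (simp only: mult.commute[of A])
      then show ?thesis unfolding A_def Nj_def using mult_left_le_imp_le vol_pos by blast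
    qed
    have card2: "real (card X2) \<le> 2 * sqrt 2 * C4 * C3 * (\<Sum>u\<in>U. f u)"
    proof -
      define J where "J = k ` X2"
      have finJ: "finite J" using X12 by (simp add: J_def)
      have "X2 = (\<Union>j\<in>J. Y j)" by (auto simp: J_def Y_def)
      then have "card X2 \<le> (\<Sum>j\<in>J. card (Y j))" using card_UN_le[OF finJ] by metis
      then have "real (card X2) \<le> (\<Sum>j\<in>J. real (card (Y j)))" unfolding of_nat_sum[symmetric] by (rule of_nat_mono)
      also have "\<dots> \<le> (\<Sum>j\<in>J. C4 * (1 / sqrt (vol j)) * (\<Sum>n\<in>{n \<in> N. 4 ^ n \<le> 2 * vol j}. 8 ^ n * real (card (E n))))"
        by (intro sum_mono cardY)
      also have "\<dots> = (\<Sum>j\<in>J. \<Sum>n\<in>{n \<in> N. 4 ^ n \<le> 2 * vol j}. C4 * (8 ^ n * real (card (E n))) * (1 / sqrt (vol j)))"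
        unfolding sum_distrib_left by (intro sum.cong) auto
      \<comment> \<open>For fixed n the radii satisfy
        \<open>sqrt (vol j) \<ge> 2 ^ n / sqrt 2\<close>, so the reciprocals sum to a multiple of
        \<open>1 / 2 ^ n\<close>. This turns \<open>8 ^ n\<close> into \<open>4 ^ n\<close>, the
        order of magnitude of f on \<open>E n\<close>.\<close>
      also have "\<dots> = (\<Sum>n\<in>N. \<Sum>j\<in>{j \<in> J. 4 ^ n \<le> 2 * vol j}. C4 * (8 ^ n * real (card (E n))) * (1 / sqrt (vol j)))"
        using finJ finN by (rule sum.swap_restrict)
      also have "\<dots> = (\<Sum>n\<in>N. C4 * (8 ^ n * real (card (E n))) * (\<Sum>j\<in>{j \<in> J. 4 ^ n \<le> 2 * vol j}. 1 / sqrt (vol j)))"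
        by (simp only: sum_distrib_left)
      also have "\<dots> \<le> (\<Sum>n\<in>N. C4 * (8 ^ n * real (card (E n))) * (C3 / (2 ^ n / sqrt 2)))"
      proof (intro sum_mono mult_left_mono C3(2) ballI)
        fix n j assume "j \<in> {j \<in> J. 4 ^ n \<le> 2 * vol j}"
        then have "(4::real) ^ n \<le> 2 * vol j" by simp
        moreover have "(4::real) ^ n = (2 ^ n)\<^sup>2" by (simp flip: power_mult_distrib add: power2_eq_square)
        ultimately have "2 ^ n \<le> sqrt (2 * vol j)" by (metis real_le_rsqrt)
        then show "2 ^ n / sqrt 2 \<le> sqrt (vol j)" by (simp add: real_sqrt_mult field_simps)
      qed (use finJ C4 in auto)
      also have "\<dots> = sqrt 2 * C4 * C3 * (\<Sum>n\<in>N. 4 ^ n * real (card (E n)))"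
      proof -
        have "(8::real) ^ n = 2 ^ n * 4 ^ n" for n by (simp flip: power_mult_distrib)
        then show ?thesis unfolding sum_distrib_left by (intro sum.cong) auto
      qed
      also have "\<dots> \<le> sqrt 2 * C4 * C3 * (2 * (\<Sum>u\<in>U. f u))"
      proof (intro mult_left_mono)
        have "(\<Sum>n\<in>N. 4 ^ n * real (card (E n))) = (\<Sum>n\<in>N. \<Sum>u\<in>E n. 4 ^ n)" by (simp add: mult.commute)
        also have "\<dots> \<le> (\<Sum>n\<in>N. \<Sum>u\<in>E n. 2 * f u)" using lev by (intro sum_mono) (auto simp: E_def)
        also have "\<dots> \<le> (\<Sum>n\<in>N. \<Sum>u\<in>{u \<in> U. lev u = n}. 2 * f u)"
          using U f0 by (intro sum_mono sum_mono2) (auto simp: E_def)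
        also have "\<dots> = (\<Sum>u\<in>U. 2 * f u)" using U finN by (intro sum.group) (auto simp: N_def)
        finally show "(\<Sum>n\<in>N. 4 ^ n * real (card (E n))) \<le> 2 * (\<Sum>u\<in>U. f u)" by (simp add: sum_distrib_left)
      qed (use C3 C4 in auto)
      finally show ?thesis by simp
    qed
    have "card X = card X1 + card X2"
      using X12 X unfolding X2_def by (metis card_Diff_subset card_mono le_add_diff_inverse)
    then have "real (card X) \<le> (C1 + 2 * sqrt 2 * C4 * C3) * (\<Sum>u\<in>U. f u)"
      using card1 card2 by (simp add: distrib_right)
    also have "\<dots> \<le> (C1 + 2 * sqrt 2 * C4 * C3) * (\<Sum>\<^sub>\<infinity>u\<in>carrier G. f u)"
      using U f C1 C3 C4 by (intro mult_left_mono finite_sum_le_infsum add_nonneg_nonneg) auto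
    finally show "real (card X) \<le> (C1 + 2 * sqrt 2 * C4 * C3) * (\<Sum>\<^sub>\<infinity>u\<in>carrier G. f u)" .
  qed
  then show ?thesis by blast
qed

theorem weak_type_if_hyp:
  assumes hyp: "hyp \<delta>" and inf: "infinite (carrier G)"
  shows "\<exists>C. weak_type C"
proof -
  have linear: "\<exists>C. weak_type C" if A: "\<And>n. card (cb n) \<le> (2 * n + 1) * A" for A
  proof -
    \<comment> \<open>In an infinite group every sphere is nonempty, so balls grow at least
      linearly; together with a linear upper bound this gives doubling.\<close>
    have "n + 1 \<le> card (cb n)" for n
    proof -
      have "(\<Sum>i\<le>n. 1) \<le> (\<Sum>i\<le>n. card (sph i))"
        using card_sph_pos[OF inf] by (intro sum_mono) (simp add: Suc_leI)
      then show ?thesis by (simp add: card_cb_eq_sum)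
    qed
    then have "card (cb (2 * n)) \<le> 4 * A * card (cb n)" for n
    proof -
      have "card (cb (2 * n)) \<le> (2 * (2 * n) + 1) * A" by (rule A)
      also have "\<dots> \<le> (4 * (n + 1)) * A" by (intro mult_le_mono1) simp
      also have "\<dots> = 4 * A * (n + 1)" by (simp add: algebra_simps)
      also have "\<dots> \<le> 4 * A * card (cb n)" using \<open>n + 1 \<le> card (cb n)\<close> by (rule mult_le_mono2)
      finally show ?thesis .
    qed
    then show ?thesis using weak_type_doubling by blast
  qed
  from directions_or_linear_growth[OF hyp] show ?thesis
  proof
    assume "\<forall>n. card (cb n) \<le> (2 * n + 1) * card (cb (14 * \<delta>))"
    then show ?thesis using linear by blast
  next
    assume "\<exists>R C. \<forall>g\<in>carrier G. \<forall>h\<in>carrier G. \<exists>a\<in>cb R. gp \<one> g (a \<otimes> h) \<le> real C"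
    then obtain K where K: "\<And>i j. card (sph i) * card (sph j) \<le> K * card (sph (i + j))"
      using sph_supermultiplicative[OF hyp inf] by meson
    show ?thesis
    proof (cases "\<forall>M. \<exists>i. M < card (sph i)")
      case True
      then have "\<And>M. \<exists>i. M < card (sph i)" by blast
      note growth = exp_growth_partial_sums[OF K card_sph_pos[OF inf] this, folded card_cb_eq_sum]
      obtain B where "B > 0" "\<And>m n. vol m * vol n \<le> B * vol (m + n)" using growth(2) by blast
      then show ?thesis by (rule weak_type_exp_growth[OF hyp growth(1)])
    next
      case False
      then obtain M where M: "\<And>i. card (sph i) \<le> M" by (auto simp: not_less)
      have "card (cb n) \<le> (2 * n + 1) * M" for n
      proof -
        have "card (cb n) \<le> (\<Sum>i\<le>n. M)" unfolding card_cb_eq_sum by (intro sum_mono M)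
        then show ?thesis by (simp add: add_mult_distrib)
      qed
      then show ?thesis by (rule linear)
    qed
  qed
qed

section \<open>From the Hardy-Littlewood operator to finite sets of centres\<close>

lemma real_len_less_iff: "0 < r \<Longrightarrow> real n < r \<longleftrightarrow> n \<le> nat (\<lceil>r\<rceil> - 1)"
  by linarith

text \<open>Lengths are integers, and \<open>\<lceil>r\<rceil> - 1\<close> is the largest integer
  strictly below r.\<close>

lemma word_ball_eq: "0 < r \<Longrightarrow> word_ball G S r = cb (nat (\<lceil>r\<rceil> - 1))"
  unfolding word_ball_def cb_def by (simp add: real_len_less_iff)

lemma word_dist_ball_eq: "0 < r \<Longrightarrow> {u \<in> carrier G. word_dist G S x u < r} = bl x (nat (\<lceil>r\<rceil> - 1))"
  unfolding word_dist_eq bl_def by (simp add: real_len_less_iff)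

text \<open>The strict hypothesis yields a single radius although the supremum need not be attained;
  nonnegative r0 makes this radius positive and the ball nonempty.\<close>

lemma hardy_littlewood_less_witness:
  assumes "ereal t < hardy_littlewood G S r0 f x" "0 \<le> r0"
  shows "\<exists>k. t * vol k < (\<Sum>u\<in>bl x k. norm (f u))"
proof -
  obtain r where r: "r0 < r"
    "ereal t < ereal ((1 / real (card (word_ball G S r))) * (\<Sum>u\<in>{u \<in> carrier G. word_dist G S x u < r}. norm (f u)))"
    using assms(1) unfolding hardy_littlewood_def less_SUP_iff by auto
  define k where "k = nat (\<lceil>r\<rceil> - 1)"
  have "0 < r" using r(1) assms(2) by simp
  then have "t < 1 / vol k * (\<Sum>u\<in>bl x k. norm (f u))"
    using r(2) by (simp only: word_ball_eq word_dist_ball_eq k_def ereal_less(1) ereal_less_eq less_ereal.simps)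
  then show ?thesis using card_cb_pos[of k] by (auto simp: field_simps)
qed

end

text \<open>Finiteness is asserted separately because \<open>card\<close> is 0 on infinite sets,
  where the numerical bound alone would say nothing.\<close>

theorem theorem21:
  fixes G :: "('a, 'b) monoid_scheme"
    and S :: "'a set"
    and r0 :: real
  assumes "hyperbolic_group G"
    and "\<not> elementary_group G"
    and "finite_symmetric_generating_set G S"
    and "r0 \<ge> 0"
  shows "\<exists>C::real. \<forall>f :: 'a \<Rightarrow> complex. \<forall>\<eta>::real.
           (\<lambda>x. norm (f x)) summable_on carrier G \<longrightarrow> \<eta> > 0 \<longrightarrow>
           finite {x \<in> carrier G. hardy_littlewood G S r0 f x \<ge> ereal \<eta>} \<and>
           real (card {x \<in> carrier G. hardy_littlewood G S r0 f x \<ge> ereal \<eta>})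
             \<le> C / \<eta> * (\<Sum>\<^sub>\<infinity>x\<in>carrier G. norm (f x))"
proof -
  interpret group G using assms(1) by (simp add: hyperbolic_group_def)
  interpret word_metric G S by unfold_locales (rule assms(3))
  have inf: "infinite (carrier G)"
  proof
    assume "finite (carrier G)"
    then have "finite (rcosets\<^bsub>G\<^esub> (generate G {\<one>\<^bsub>G\<^esub>}))" by (simp add: RCOSETS_def)
    then show False using assms(2) one_closed unfolding elementary_group_def by blast
  qed
  obtain \<delta> where "hyp \<delta>" using hyp_if_hyperbolic_group[OF assms(1)] by blast
  then obtain C where C: "weak_type C" using weak_type_if_hyp[OF _ inf] by blast
  have main: "finite Z \<and> real (card Z) \<le> 2 * C / \<eta> * (\<Sum>\<^sub>\<infinity>x\<in>carrier G. norm (f x))"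
    if f: "(\<lambda>x. norm (f x)) summable_on carrier G" and \<eta>: "\<eta> > 0"
      and Z: "Z = {x \<in> carrier G. hardy_littlewood G S r0 f x \<ge> ereal \<eta>}"
    for f :: "'a \<Rightarrow> complex" and \<eta> and Z
  proof -
    let ?b = "2 * C / \<eta> * (\<Sum>\<^sub>\<infinity>x\<in>carrier G. norm (f x))"
    have bound: "real (card X) \<le> ?b" if X: "finite X" "X \<subseteq> Z" for X
    proof -
      \<comment> \<open>A supremum equal to \<eta> need not be reached by any average, so the level
        is halved; this is the factor 2 in the final constant.\<close>
      have "\<exists>k. \<eta> / 2 * vol k < (\<Sum>u\<in>bl x k. norm (f u))" if "x \<in> X" for x
      proof (rule hardy_littlewood_less_witness)
        have "ereal (\<eta> / 2) < ereal \<eta>" using \<eta> by simp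
        also have "\<dots> \<le> hardy_littlewood G S r0 f x" using that X Z by blast
        finally show "ereal (\<eta> / 2) < hardy_littlewood G S r0 f x" .
      qed (rule assms(4))
      then obtain k where k: "\<And>x. x \<in> X \<Longrightarrow> \<eta> / 2 * vol (k x) < (\<Sum>u\<in>bl x (k x). norm (f u))"
        by metis
      have "\<forall>x\<in>X. vol (k x) < (\<Sum>u\<in>bl x (k x). 2 / \<eta> * norm (f u))"
        unfolding sum_distrib_left[symmetric] using k \<eta> by (simp add: field_simps)
      moreover have "(\<lambda>u. 2 / \<eta> * norm (f u)) summable_on carrier G"
        using f by (rule summable_on_cmult_right)
      ultimately have "real (card X) \<le> C * (\<Sum>\<^sub>\<infinity>u\<in>carrier G. 2 / \<eta> * norm (f u))"
        using C[unfolded weak_type_def, rule_format, of X "\<lambda>u. 2 / \<eta> * norm (f u)" k] X Z \<eta> by auto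
      also have "(\<Sum>\<^sub>\<infinity>u\<in>carrier G. 2 / \<eta> * norm (f u)) = 2 / \<eta> * (\<Sum>\<^sub>\<infinity>u\<in>carrier G. norm (f u))"
        by (rule infsum_cmult_right')
      finally show ?thesis by (simp add: mult.commute)
    qed
    \<comment> \<open>One bound holds for all finite subsets of Z, which rules out that Z is
      infinite.\<close>
    have "finite Z \<and> card Z \<le> nat \<lfloor>?b\<rfloor>"
    proof (rule finite_if_finite_subsets_card_bdd)
      fix X assume "X \<subseteq> Z" "finite X"
      then show "card X \<le> nat \<lfloor>?b\<rfloor>" using bound[of X] by linarith
    qed
    then show ?thesis using bound[of Z] by blast
  qed
  show ?thesis using main by (intro exI[of _ "2 * C"]) blast
qed

end
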